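(* Let $(f^t)_{t\in\mathbb R}$ be a Bowen flow on $\mathbb R^2$ generated by a vector field $V:\mathbb R^2\to\mathbb R^2$, with attracting closed curve $\gamma$, and let $U$ be an open set contained in the region enclosed by $\gamma$, near $\gamma$, such that the $\omega$-limit set of $(f^t(x))_{t\in\mathbb R}$ equals $\gamma$ for every $x\in U$. Then every point $x\in U$ is Lyapunov irregular for the vector $V(x)$, that is, the limit $\lim_{t\to\infty}\frac1t\log\|Df^t(x)V(x)\|$ does not exist.
   Context: A Bowen flow is a smooth flow $(f^t)_{t\in\mathbb R}$ on $\mathbb R^2$ generated by a vector field $V:\mathbb R^2\to\mathbb R^2$ of class $\mathcal C^{1+\alpha}$ for some $\alpha>0$, with two equilibrium points $p$ and $\hat p$ of saddle type and two heteroclinic orbits $\gamma_1,\gamma_2$ connecting these points, $\gamma_1$ being included in the unstable manifold of $p$ (and the stable manifold of $\hat p$) and $\gamma_2$ in the stable manifold of $p$ (and the unstable manifold of $\hat p$), such that the closed curve $\gamma:=\gamma_1\cup\gamma_2\cup\{p\}\cup\{\hat p\}$ is attracting in the following sense: if $\alpha_+$ and $-\alpha_-$ denote the expanding and contracting eigenvalues of the linearization of $V$ at $p$, and $\beta_+$ and $-\beta_-$ those of the linearization of $V$ at $\hat p$ (with $\alpha_\pm,\beta_\pm>0$), then $\alpha_-\beta_->\alpha_+\beta_+$. *)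

theory Defs
  imports "HOL-Analysis.Analysis"
begin

text \<open>The class \<open>C\<^sup>1\<close>: the derivative exists everywhere and is continuous in operator norm.\<close>

definition C1_map :: "('a::real_normed_vector \<Rightarrow> 'b::real_normed_vector) \<Rightarrow> bool" where
  "C1_map g \<longleftrightarrow> (\<exists>g' :: 'a \<Rightarrow> 'a \<Rightarrow>\<^sub>L 'b.
     (\<forall>x. (g has_derivative blinfun_apply (g' x)) (at x)) \<and> continuous_on UNIV g')"

text \<open>The class \<open>C\<close> to the power \<open>1 + \<alpha>\<close>, with the Hoelder condition on the derivative required
  only locally, the domain being non-compact.\<close>

definition C1_Holder :: "real \<Rightarrow> ('a::real_normed_vector \<Rightarrow> 'b::real_normed_vector) \<Rightarrow> bool" where
  "C1_Holder \<alpha> g \<longleftrightarrow> (\<exists>g' :: 'a \<Rightarrow> 'a \<Rightarrow>\<^sub>L 'b.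
     (\<forall>x. (g has_derivative blinfun_apply (g' x)) (at x)) \<and>
     (\<forall>x. \<exists>e>0. \<exists>C. \<forall>y\<in>ball x e. \<forall>z\<in>ball x e. norm (g' y - g' z) \<le> C * dist y z powr \<alpha>))"

text \<open>A complete flow is written \<open>f t x\<close>. Smoothness means \<open>C\<^sup>1\<close> jointly in time and
  space, the regularity of the flow of a \<open>C\<^sup>1\<close> vector field.\<close>

definition smooth_flow :: "(real \<Rightarrow> 'a::real_normed_vector \<Rightarrow> 'a) \<Rightarrow> bool" where
  "smooth_flow f \<longleftrightarrow> (\<forall>x. f 0 x = x) \<and> (\<forall>s t x. f (s + t) x = f s (f t x)) \<and>
     C1_map (\<lambda>(t, x). f t x)"

definition generated_by ::
    "(real \<Rightarrow> 'a::real_normed_vector \<Rightarrow> 'a) \<Rightarrow> ('a \<Rightarrow> 'a) \<Rightarrow> bool" where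
  "generated_by f V \<longleftrightarrow> (\<forall>x t. ((\<lambda>s. f s x) has_vector_derivative V (f t x)) (at t))"

definition eigenvalue_of :: "('a::real_vector \<Rightarrow> 'a) \<Rightarrow> real \<Rightarrow> bool" where
  "eigenvalue_of L c \<longleftrightarrow> (\<exists>v. v \<noteq> 0 \<and> L v = c *\<^sub>R v)"

text \<open>In dimension two the expanding eigenvalue \<open>a\<close> and the contracting eigenvalue \<open>- b\<close> are
  all the eigenvalues of the linearization, so \<open>a\<close> and \<open>b\<close> are determined by \<open>V\<close> and \<open>p\<close>.\<close>

definition saddle :: "(real^2 \<Rightarrow> real^2) \<Rightarrow> real^2 \<Rightarrow> real \<Rightarrow> real \<Rightarrow> bool" where
  "saddle V p a b \<longleftrightarrow> V p = 0 \<and> a > 0 \<and> b > 0 \<and>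
     eigenvalue_of (frechet_derivative V (at p)) a \<and>
     eigenvalue_of (frechet_derivative V (at p)) (- b)"

definition stable_manifold ::
    "(real \<Rightarrow> 'a::topological_space \<Rightarrow> 'a) \<Rightarrow> 'a \<Rightarrow> 'a set" where
  "stable_manifold f p = {x. ((\<lambda>t. f t x) \<longlongrightarrow> p) at_top}"

definition unstable_manifold ::
    "(real \<Rightarrow> 'a::topological_space \<Rightarrow> 'a) \<Rightarrow> 'a \<Rightarrow> 'a set" where
  "unstable_manifold f p = {x. ((\<lambda>t. f t x) \<longlongrightarrow> p) at_bot}"

definition flow_orbit :: "(real \<Rightarrow> 'a \<Rightarrow> 'a) \<Rightarrow> 'a \<Rightarrow> 'a set" where
  "flow_orbit f x = range (\<lambda>t. f t x)"

definition heteroclinic_orbit ::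
    "(real \<Rightarrow> 'a::topological_space \<Rightarrow> 'a) \<Rightarrow> 'a \<Rightarrow> 'a \<Rightarrow> 'a set \<Rightarrow> bool" where
  "heteroclinic_orbit f p q \<Gamma> \<longleftrightarrow> p \<noteq> q \<and> (\<exists>x. \<Gamma> = flow_orbit f x) \<and>
     \<Gamma> \<subseteq> unstable_manifold f p \<and> \<Gamma> \<subseteq> stable_manifold f q"

definition bowen_flow ::
    "(real \<Rightarrow> real^2 \<Rightarrow> real^2) \<Rightarrow> (real^2 \<Rightarrow> real^2) \<Rightarrow> (real^2) set \<Rightarrow> bool" where
  "bowen_flow f V \<gamma> \<longleftrightarrow>
     smooth_flow f \<and> generated_by f V \<and> (\<exists>\<alpha>. 0 < \<alpha> \<and> \<alpha> \<le> 1 \<and> C1_Holder \<alpha> V) \<and>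
     (\<exists>p p' \<gamma>\<^sub>1 \<gamma>\<^sub>2 a_plus a_minus b_plus b_minus.
        saddle V p a_plus a_minus \<and> saddle V p' b_plus b_minus \<and>
        heteroclinic_orbit f p p' \<gamma>\<^sub>1 \<and> heteroclinic_orbit f p' p \<gamma>\<^sub>2 \<and>
        \<gamma> = \<gamma>\<^sub>1 \<union> \<gamma>\<^sub>2 \<union> {p} \<union> {p'} \<and>
        a_minus * b_minus > a_plus * b_plus)"

definition omega_limit_set ::
    "(real \<Rightarrow> 'a::topological_space \<Rightarrow> 'a) \<Rightarrow> 'a \<Rightarrow> 'a set" where
  "omega_limit_set f x =
     {y. \<exists>\<tau>. filterlim \<tau> at_top sequentially \<and> (\<lambda>n::nat. f (\<tau> n) x) \<longlonglongrightarrow> y}"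

text \<open>The limit is excluded in the extended reals, so that divergence to an infinite value does
  not count as irregularity.\<close>

definition lyapunov_irregular ::
    "(real \<Rightarrow> 'a::real_normed_vector \<Rightarrow> 'a) \<Rightarrow> 'a \<Rightarrow> 'a \<Rightarrow> bool" where
  "lyapunov_irregular f x v \<longleftrightarrow>
     \<not> (\<exists>L::ereal. ((\<lambda>t. ereal (1 / t * ln (norm (frechet_derivative (f t) (at x) v)))) \<longlongrightarrow> L) at_top)"

end

theory Submission
  imports Defs
begin

text \<open>Invariance of the generating field gives \<open>Df\<^sup>t(x) V(x) = V(f\<^sup>t x)\<close>, so the claim
  concerns \<open>ln \<bar>V\<bar> / t\<close> along the orbit of \<open>x\<close>. The orbit returns close to a regular point of
  \<open>\<gamma>\<close> at arbitrarily late times, so the only possible limit is \<open>0\<close>. On the other hand a passage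
  of duration \<open>T\<close> near a saddle ends at distance at most about \<open>exp (- b T)\<close> from the outgoing
  connection, \<open>- b\<close> being the contracting eigenvalue there, and an orbit starting at distance \<open>d\<close>
  from the incoming connection stays near the next saddle for a time at least about
  \<open>ln (1 / d) / a'\<close>. Since the product of the ratios \<open>b / a'\<close> over both saddles exceeds \<open>1\<close>, the
  durations grow geometrically, so a passage of duration \<open>T\<close> starts at a time \<open>t = O(T)\<close>. At its
  midpoint \<open>\<bar>V\<bar>\<close> is exponentially small in \<open>T\<close>, which excludes the limit \<open>0\<close>. No invariant
  manifold or linearization theorem is needed: the estimates compare the orbit with a reference
  orbit in \<open>\<gamma>\<close>, and differences of orbits near a saddle obey a perturbed linear equation with
  invariant cones.\<close>

section \<open>Perturbed linear saddles\<close>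

text \<open>A one-sided Gronwall inequality: \<open>g t * exp (- k * t)\<close> is nonincreasing.
  With a negative \<open>k\<close> it gives decay.\<close>

lemma exp_growth_bound:
  fixes g g' :: "real \<Rightarrow> real"
  assumes "t0 \<le> t1"
    and D: "\<And>t. t0 \<le> t \<Longrightarrow> t \<le> t1 \<Longrightarrow> (g has_real_derivative g' t) (at t)"
    and le: "\<And>t. t0 \<le> t \<Longrightarrow> t \<le> t1 \<Longrightarrow> g' t \<le> k * g t"
  shows "g t1 \<le> g t0 * exp (k * (t1 - t0))"
proof -
  define G where "G t = g t * exp (- k * t)" for t
  have "G t1 \<le> G t0"
  proof (rule DERIV_nonpos_imp_nonincreasing[OF assms(1)])
    fix t assume t: "t0 \<le> t" "t \<le> t1"
    have "(G has_real_derivative (g' t - k * g t) * exp (- k * t)) (at t)"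
      unfolding G_def by (auto intro!: derivative_eq_intros D[OF t] simp: algebra_simps)
    moreover have "(g' t - k * g t) * exp (- k * t) \<le> 0"
      using le[OF t] by (simp add: mult_nonpos_nonneg)
    ultimately show "\<exists>y. (G has_real_derivative y) (at t) \<and> y \<le> 0" by blast
  qed
  then have "g t1 * exp (- k * t1) * exp (k * t1) \<le> g t0 * exp (- k * t0) * exp (k * t1)"
    unfolding G_def by (intro mult_right_mono) auto
  then show ?thesis
    by (simp add: mult.assoc exp_add[symmetric] algebra_simps)
qed

lemma mult_perturbation_bound:
  fixes X X' :: real
  assumes "\<bar>X' - k * X\<bar> \<le> e * m" "\<bar>X\<bar> \<le> m" "0 \<le> e"
  shows "\<bar>X * X' - k * X\<^sup>2\<bar> \<le> e * m\<^sup>2"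
proof -
  have "\<bar>X * X' - k * X\<^sup>2\<bar> = \<bar>X\<bar> * \<bar>X' - k * X\<bar>"
    by (simp add: abs_mult[symmetric] power2_eq_square algebra_simps)
  also have "\<dots> \<le> m * (e * m)"
    using assms by (intro mult_mono) auto
  finally show ?thesis by (simp add: power2_eq_square algebra_simps)
qed

lemma max_abs_power2_le: "(max \<bar>x\<bar> \<bar>y\<bar>)\<^sup>2 \<le> x\<^sup>2 + (y::real)\<^sup>2"
  by (auto simp: max_def)

text \<open>\<open>U\<close> and \<open>S\<close> stand for the unstable and stable coordinates of a
  difference of two orbits. The nonlinear terms enter only as an error relative to the max norm, and
  \<open>2 * e < a\<close>, \<open>2 * e < b\<close> leave room for that error in the cone
  argument.\<close>

locale perturbed_saddle =
  fixes U S U' S' :: "real \<Rightarrow> real" and a b e t0 t1 :: real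
  assumes t01: "t0 \<le> t1" and e0: "0 < e" and ea: "2 * e < a" and eb: "2 * e < b"
    and DU: "\<And>t. t0 \<le> t \<Longrightarrow> t \<le> t1 \<Longrightarrow> (U has_real_derivative U' t) (at t)"
    and DS: "\<And>t. t0 \<le> t \<Longrightarrow> t \<le> t1 \<Longrightarrow> (S has_real_derivative S' t) (at t)"
    and EU: "\<And>t. t0 \<le> t \<Longrightarrow> t \<le> t1 \<Longrightarrow> \<bar>U' t - a * U t\<bar> \<le> e * max \<bar>U t\<bar> \<bar>S t\<bar>"
    and ES: "\<And>t. t0 \<le> t \<Longrightarrow> t \<le> t1 \<Longrightarrow> \<bar>S' t + b * S t\<bar> \<le> e * max \<bar>U t\<bar> \<bar>S t\<bar>"
begin

text \<open>Multiplying the two equations by \<open>U\<close> and \<open>S\<close> controls half the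
  derivatives of the squares, which are differentiable where the absolute values are not. The last
  bound trades the max norm for the Euclidean one.\<close>

lemma product_bounds:
  assumes t: "t0 \<le> t" "t \<le> t1"
  shows "U t * U' t \<le> a * (U t)\<^sup>2 + e * (max \<bar>U t\<bar> \<bar>S t\<bar>)\<^sup>2"
    and "a * (U t)\<^sup>2 - e * (max \<bar>U t\<bar> \<bar>S t\<bar>)\<^sup>2 \<le> U t * U' t"
    and "S t * S' t \<le> - (b * (S t)\<^sup>2) + e * (max \<bar>U t\<bar> \<bar>S t\<bar>)\<^sup>2"
    and "e * (max \<bar>U t\<bar> \<bar>S t\<bar>)\<^sup>2 \<le> e * (U t)\<^sup>2 + e * (S t)\<^sup>2"
proof -
  have "\<bar>U t * U' t - a * (U t)\<^sup>2\<bar> \<le> e * (max \<bar>U t\<bar> \<bar>S t\<bar>)\<^sup>2"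
    by (rule mult_perturbation_bound[OF EU[OF t]]) (use e0 in auto)
  then show "U t * U' t \<le> a * (U t)\<^sup>2 + e * (max \<bar>U t\<bar> \<bar>S t\<bar>)\<^sup>2"
    "a * (U t)\<^sup>2 - e * (max \<bar>U t\<bar> \<bar>S t\<bar>)\<^sup>2 \<le> U t * U' t" unfolding abs_le_iff by linarith+
  have "\<bar>S t * S' t - (- b) * (S t)\<^sup>2\<bar> \<le> e * (max \<bar>U t\<bar> \<bar>S t\<bar>)\<^sup>2"
    by (rule mult_perturbation_bound) (use ES[OF t] e0 in auto)
  then show "S t * S' t \<le> - (b * (S t)\<^sup>2) + e * (max \<bar>U t\<bar> \<bar>S t\<bar>)\<^sup>2"
    unfolding abs_le_iff by linarith
  show "e * (max \<bar>U t\<bar> \<bar>S t\<bar>)\<^sup>2 \<le> e * (U t)\<^sup>2 + e * (S t)\<^sup>2"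
    unfolding distrib_left[symmetric] using e0 max_abs_power2_le by (intro mult_left_mono) auto
qed

text \<open>The contraction term in \<open>S\<close> has the favourable sign and is dropped; each of
  the two products contributes one error \<open>e\<close>. The bound holds without any cone
  condition and limits how fast orbits separate.\<close>

lemma energy_bound:
  "(U t1)\<^sup>2 + (S t1)\<^sup>2 \<le> ((U t0)\<^sup>2 + (S t0)\<^sup>2) * exp (2 * (a + 2 * e) * (t1 - t0))"
proof (rule exp_growth_bound[OF t01])
  fix t assume t: "t0 \<le> t" "t \<le> t1"
  show "((\<lambda>t. (U t)\<^sup>2 + (S t)\<^sup>2) has_real_derivative 2 * U t * U' t + 2 * S t * S' t) (at t)"
    by (auto intro!: derivative_eq_intros DU[OF t] DS[OF t])
  have "0 \<le> b * (S t)\<^sup>2" "0 \<le> a * (S t)\<^sup>2" using ea eb e0 by auto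
  moreover have "2 * (a + 2 * e) * ((U t)\<^sup>2 + (S t)\<^sup>2) =
      2 * (a * (U t)\<^sup>2) + 2 * (a * (S t)\<^sup>2) + 4 * (e * (U t)\<^sup>2) + 4 * (e * (S t)\<^sup>2)"
    by (simp add: algebra_simps)
  ultimately show "2 * U t * U' t + 2 * S t * S' t \<le> 2 * (a + 2 * e) * ((U t)\<^sup>2 + (S t)\<^sup>2)"
    using product_bounds(1,3,4)[OF t] by linarith
qed

text \<open>Both \<open>a\<close> and \<open>b\<close> beat the total error \<open>2 * e\<close>, so
  \<open>(S t)\<^sup>2 - (U t)\<^sup>2\<close> is nonincreasing. The stable cone, imposed at the
  final time, therefore holds at all earlier times.\<close>

lemma stable_cone_backward:
  assumes "\<bar>U t1\<bar> \<le> \<bar>S t1\<bar>" "t0 \<le> t" "t \<le> t1"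
  shows "\<bar>U t\<bar> \<le> \<bar>S t\<bar>"
proof -
  have "(S t1)\<^sup>2 - (U t1)\<^sup>2 \<le> (S t)\<^sup>2 - (U t)\<^sup>2"
  proof (rule DERIV_nonpos_imp_nonincreasing[OF assms(3)])
    fix r assume "t \<le> r" "r \<le> t1"
    then have r: "t0 \<le> r" "r \<le> t1" using assms by auto
    have D: "((\<lambda>t. (S t)\<^sup>2 - (U t)\<^sup>2) has_real_derivative 2 * S r * S' r - 2 * U r * U' r) (at r)"
      by (auto intro!: derivative_eq_intros DU[OF r] DS[OF r])
    have "2 * e * (S r)\<^sup>2 \<le> b * (S r)\<^sup>2" "2 * e * (U r)\<^sup>2 \<le> a * (U r)\<^sup>2"
      using ea eb by (intro mult_right_mono; simp)+
    then have "2 * S r * S' r - 2 * U r * U' r \<le> 0"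
      using product_bounds(2-4)[OF r] by linarith
    then show "\<exists>y. ((\<lambda>t. (S t)\<^sup>2 - (U t)\<^sup>2) has_real_derivative y) (at r) \<and> y \<le> 0"
      using D by blast
  qed
  moreover have "(U t1)\<^sup>2 \<le> (S t1)\<^sup>2" using assms(1) by (simp add: abs_le_square_iff)
  ultimately have "(U t)\<^sup>2 \<le> (S t)\<^sup>2" by simp
  then show ?thesis by (simp add: abs_le_square_iff)
qed

text \<open>In the stable cone the max norm is \<open>\<bar>S t\<bar>\<close>, so the perturbation
  costs at most \<open>e\<close> of the contraction rate.\<close>

lemma stable_cone_decay:
  assumes "\<bar>U t1\<bar> \<le> \<bar>S t1\<bar>"
  shows "\<bar>S t1\<bar> \<le> \<bar>S t0\<bar> * exp (- (b - e) * (t1 - t0))"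
proof -
  have "(S t1)\<^sup>2 \<le> (S t0)\<^sup>2 * exp ((- 2 * (b - e)) * (t1 - t0))"
  proof (rule exp_growth_bound[OF t01])
    fix t assume t: "t0 \<le> t" "t \<le> t1"
    show "((\<lambda>t. (S t)\<^sup>2) has_real_derivative 2 * S t * S' t) (at t)"
      by (auto intro!: derivative_eq_intros DS[OF t])
    have "max \<bar>U t\<bar> \<bar>S t\<bar> = \<bar>S t\<bar>"
      using stable_cone_backward[OF assms t] by (rule max_absorb2)
    then have "S t * S' t \<le> - (b * (S t)\<^sup>2) + e * (S t)\<^sup>2"
      using product_bounds(3)[OF t] by simp
    then show "2 * S t * S' t \<le> (- 2 * (b - e)) * (S t)\<^sup>2"
      by (simp add: algebra_simps)
  qed
  also have "\<dots> = (\<bar>S t0\<bar> * exp (- (b - e) * (t1 - t0)))\<^sup>2"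
    by (simp add: power_mult_distrib exp_double[symmetric])
  finally show ?thesis
    using abs_le_square_iff[of "S t1" "\<bar>S t0\<bar> * exp (- (b - e) * (t1 - t0))"] by simp
qed

text \<open>Reversing time exchanges the stable and the unstable direction, so estimates in the
  unstable cone follow from those in the stable cone.\<close>

lemma time_reversal:
  "perturbed_saddle (\<lambda>t. S (- t)) (\<lambda>t. U (- t)) (\<lambda>t. - S' (- t)) (\<lambda>t. - U' (- t)) b a e (- t1) (- t0)"
proof
  fix t assume t: "- t1 \<le> t" "t \<le> - t0"
  then have t': "t0 \<le> - t" "- t \<le> t1" by auto
  show "((\<lambda>t. S (- t)) has_real_derivative - S' (- t)) (at t)"
    "((\<lambda>t. U (- t)) has_real_derivative - U' (- t)) (at t)"
    using DERIV_chain2[OF DS[OF t'] DERIV_minus[OF DERIV_ident]]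
      DERIV_chain2[OF DU[OF t'] DERIV_minus[OF DERIV_ident]] by auto
  show "\<bar>- S' (- t) - b * S (- t)\<bar> \<le> e * max \<bar>S (- t)\<bar> \<bar>U (- t)\<bar>"
    "\<bar>- U' (- t) + a * U (- t)\<bar> \<le> e * max \<bar>S (- t)\<bar> \<bar>U (- t)\<bar>"
  proof -
    have "\<bar>- S' (- t) - b * S (- t)\<bar> = \<bar>S' (- t) + b * S (- t)\<bar>"
      "\<bar>- U' (- t) + a * U (- t)\<bar> = \<bar>U' (- t) - a * U (- t)\<bar>" by linarith+
    then show "\<bar>- S' (- t) - b * S (- t)\<bar> \<le> e * max \<bar>S (- t)\<bar> \<bar>U (- t)\<bar>"
      "\<bar>- U' (- t) + a * U (- t)\<bar> \<le> e * max \<bar>S (- t)\<bar> \<bar>U (- t)\<bar>"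
      using ES[OF t'] EU[OF t'] by (simp_all add: max.commute)
  qed
qed (use t01 e0 ea eb in auto)

lemma unstable_cone_growth:
  assumes "\<bar>S t0\<bar> \<le> \<bar>U t0\<bar>"
  shows "\<bar>U t0\<bar> \<le> \<bar>U t1\<bar> * exp (- (a - e) * (t1 - t0))"
  using perturbed_saddle.stable_cone_decay[OF time_reversal] assms by simp

end

lemma perturbed_saddle_subinterval:
  assumes "perturbed_saddle U S U' S' a b e t0 t1" "t0 \<le> r0" "r0 \<le> r1" "r1 \<le> t1"
  shows "perturbed_saddle U S U' S' a b e r0 r1"
  using assms unfolding perturbed_saddle_def by auto

text \<open>If \<open>S\<close> dominates at the midpoint, it has been contracting since
  \<open>t0\<close>; if \<open>U\<close> dominates, it keeps expanding until \<open>t1\<close>,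
  where it is still at most \<open>h\<close>. Either way half of the duration counts.\<close>

lemma perturbed_saddle_midpoint:
  assumes "perturbed_saddle U S U' S' a b e t0 t1"
    and bd: "\<And>t. t0 \<le> t \<Longrightarrow> t \<le> t1 \<Longrightarrow> \<bar>U t\<bar> \<le> h \<and> \<bar>S t\<bar> \<le> h"
    and c: "c \<le> a - e" "c \<le> b - e"
  shows "max \<bar>U ((t0 + t1) / 2)\<bar> \<bar>S ((t0 + t1) / 2)\<bar> \<le> h * exp (- c * ((t1 - t0) / 2))"
proof -
  interpret perturbed_saddle U S U' S' a b e t0 t1 by fact
  define m where "m = (t0 + t1) / 2"
  have m: "t0 \<le> m" "m \<le> t1" "m - t0 = (t1 - t0) / 2" "t1 - m = (t1 - t0) / 2"
    using t01 by (auto simp: m_def field_simps)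
  have h: "0 \<le> h" using bd[OF m(1,2)] by auto
  have mono: "x * exp (- k * ((t1 - t0) / 2)) \<le> h * exp (- c * ((t1 - t0) / 2))"
    if "x \<le> h" "c \<le> k" for x k
    using that h t01 by (intro mult_mono) (auto intro!: mult_right_mono)
  consider "\<bar>U m\<bar> \<le> \<bar>S m\<bar>" | "\<bar>S m\<bar> \<le> \<bar>U m\<bar>" by linarith
  then have "max \<bar>U m\<bar> \<bar>S m\<bar> \<le> h * exp (- c * ((t1 - t0) / 2))"
  proof cases
    case 1
    have "\<bar>S m\<bar> \<le> \<bar>S t0\<bar> * exp (- (b - e) * (m - t0))"
      using perturbed_saddle.stable_cone_decay[OF perturbed_saddle_subinterval[OF assms(1) _ m(1,2)]] 1
      by simp
    also have "\<dots> \<le> h * exp (- c * ((t1 - t0) / 2))"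
      unfolding m using mono bd[of t0] t01 c by blast
    finally show ?thesis using 1 by simp
  next
    case 2
    have "\<bar>U m\<bar> \<le> \<bar>U t1\<bar> * exp (- (a - e) * (t1 - m))"
      using perturbed_saddle.unstable_cone_growth[OF perturbed_saddle_subinterval[OF assms(1) m(1,2)]] 2
      by simp
    also have "\<dots> \<le> h * exp (- c * ((t1 - t0) / 2))"
      unfolding m using mono bd[of t1] t01 c by blast
    finally show ?thesis using 2 by simp
  qed
  then show ?thesis unfolding m_def .
qed

section \<open>Flows\<close>

lemma C1_Holder_imp_C1_map:
  assumes "C1_Holder \<alpha> V" "0 < \<alpha>"
  shows "C1_map V"
proof -
  obtain V' where V': "\<And>x. (V has_derivative blinfun_apply (V' x)) (at x)"
    and H: "\<And>x. \<exists>e>0. \<exists>C. \<forall>y\<in>ball x e. \<forall>z\<in>ball x e. norm (V' y - V' z) \<le> C * dist y z powr \<alpha>"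
    using assms unfolding C1_Holder_def by blast
  have "(V' \<longlongrightarrow> V' x) (at x)" for x
  proof -
    obtain e C where e: "e > 0"
      "\<And>y z. y \<in> ball x e \<Longrightarrow> z \<in> ball x e \<Longrightarrow> norm (V' y - V' z) \<le> C * dist y z powr \<alpha>"
      using H by blast
    have "((\<lambda>y. C * dist y x powr \<alpha>) \<longlongrightarrow> C * dist x x powr \<alpha>) (at x)"
      using assms(2) by (intro tendsto_intros) auto
    then have "((\<lambda>y. C * dist y x powr \<alpha>) \<longlongrightarrow> 0) (at x)" by simp
    moreover have "eventually (\<lambda>y. norm (V' y - V' x) \<le> C * dist y x powr \<alpha>) (at x)"
      using e by (auto simp: eventually_at dist_commute intro!: exI[of _ e])
    ultimately have "((\<lambda>y. V' y - V' x) \<longlongrightarrow> 0) (at x)"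
      by (rule Lim_null_comparison[rotated])
    then show ?thesis by (simp add: LIM_zero_iff)
  qed
  then have "continuous_on UNIV V'"
    by (simp add: continuous_on_def)
  then show ?thesis using V' unfolding C1_map_def by blast
qed

text \<open>The mean value inequality is applied to \<open>g\<close> minus its linear part at
  \<open>x\<close>. Both \<open>y\<close> and \<open>z\<close> are free, which is what differences
  of two orbits require.\<close>

lemma continuously_differentiable_imp_strict:
  fixes g' :: "'a::real_normed_vector \<Rightarrow> 'a \<Rightarrow>\<^sub>L 'b::real_normed_vector"
  assumes g': "\<And>x. (g has_derivative blinfun_apply (g' x)) (at x)"
    and cont: "continuous_on UNIV g'" and e: "0 < e"
  shows "\<exists>d>0. \<forall>y\<in>ball x d. \<forall>z\<in>ball x d.
    norm (g y - g z - blinfun_apply (g' x) (y - z)) \<le> e * norm (y - z)"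
proof -
  obtain d where d: "d > 0" "\<And>y. dist y x < d \<Longrightarrow> dist (g' y) (g' x) < e"
    using cont e unfolding continuous_on_iff by (metis UNIV_I)
  have "norm (g y - g z - blinfun_apply (g' x) (y - z)) \<le> e * norm (y - z)"
    if "y \<in> ball x d" "z \<in> ball x d" for y z
  proof -
    define k where "k y = g y - blinfun_apply (g' x) y" for y
    have "norm (k y - k z) \<le> e * norm (y - z)"
    proof (rule differentiable_bound[OF _ _ _ that])
      fix w assume w: "w \<in> ball x d"
      show "(k has_derivative blinfun_apply (g' w - g' x)) (at w within ball x d)"
        unfolding k_def blinfun.diff_left
        by (intro has_derivative_diff has_derivative_at_withinI[OF g']
            bounded_linear_imp_has_derivative blinfun.bounded_linear_right)
      show "onorm (blinfun_apply (g' w - g' x)) \<le> e"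
        using d(2)[of w] w by (simp add: norm_blinfun.rep_eq[symmetric] dist_norm norm_minus_commute)
    qed simp
    moreover have "k y - k z = g y - g z - blinfun_apply (g' x) (y - z)"
      by (simp add: k_def blinfun.diff_right)
    ultimately show ?thesis by simp
  qed
  then show ?thesis using d(1) by blast
qed

lemma C1_map_locally_Lipschitz:
  assumes "C1_map g"
  shows "\<exists>d>0. \<exists>K. \<forall>y\<in>ball x d. \<forall>z\<in>ball x d. norm (g y - g z) \<le> K * norm (y - z)"
proof -
  obtain g' where g': "\<And>x. (g has_derivative blinfun_apply (g' x)) (at x)" "continuous_on UNIV g'"
    using assms unfolding C1_map_def by blast
  obtain d where d: "d > 0" "\<And>y z. y \<in> ball x d \<Longrightarrow> z \<in> ball x d \<Longrightarrow>
    norm (g y - g z - blinfun_apply (g' x) (y - z)) \<le> 1 * norm (y - z)"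
    using continuously_differentiable_imp_strict[OF g', of 1 x] by auto
  have "norm (g y - g z) \<le> (1 + norm (g' x)) * norm (y - z)"
    if "y \<in> ball x d" "z \<in> ball x d" for y z
    using d(2)[OF that] norm_blinfun[of "g' x" "y - z"]
      norm_triangle_sub[of "g y - g z" "blinfun_apply (g' x) (y - z)"]
    by (simp add: algebra_simps)
  then show ?thesis using d(1) by blast
qed

locale c1_flow =
  fixes f :: "real \<Rightarrow> 'a::real_normed_vector \<Rightarrow> 'a" and V :: "'a \<Rightarrow> 'a"
  assumes smooth: "smooth_flow f" and gen: "generated_by f V"
begin

lemma flow_0 [simp]: "f 0 x = x"
  using smooth by (simp add: smooth_flow_def)

lemma flow_add: "f (s + t) x = f s (f t x)"
  using smooth by (simp add: smooth_flow_def)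

lemma flow_inverse [simp]: "f (- t) (f t x) = x" "f t (f (- t) x) = x"
  by (simp_all add: flow_add[symmetric])

lemma flow_deriv: "((\<lambda>s. f s x) has_vector_derivative V (f t x)) (at t)"
  using gen by (simp add: generated_by_def)

lemma flow_tendsto: "((\<lambda>s. f s x) \<longlongrightarrow> f t x) (at t)"
  using has_vector_derivative_continuous[OF flow_deriv] by (simp add: continuous_within)

lemma continuous_on_flow: "continuous_on A (\<lambda>s. f s x)"
  using flow_tendsto by (intro continuous_at_imp_continuous_on) (simp add: continuous_within)

text \<open>The identity \<open>f t (f s x) = f s (f t x)\<close> is differentiated at
  \<open>s = 0\<close>: by the chain rule on the left, by the generating property on the
  right.\<close>

lemma flow_space_derivative:
  obtains D where "(f t has_derivative D) (at x)" "D (V x) = V (f t x)"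
proof -
  obtain F' where F': "\<And>z. ((\<lambda>(t, x). f t x) has_derivative blinfun_apply (F' z)) (at z)"
    using smooth unfolding smooth_flow_def C1_map_def by blast
  define D where "D v = blinfun_apply (F' (t, x)) (0, v)" for v
  have "((\<lambda>y. (t, y)) has_derivative (\<lambda>v. (0, v))) (at x)"
    by (auto intro!: derivative_eq_intros)
  then have "(f t has_derivative D) (at x)"
    using diff_chain_at[OF _ F'] unfolding D_def comp_def by fastforce
  moreover have "D (V x) = V (f t x)"
  proof (rule vector_derivative_unique_at)
    have D0: "((\<lambda>s. f s x) has_derivative (\<lambda>h. h *\<^sub>R V x)) (at 0)"
      using flow_deriv[of x 0] by (simp add: has_vector_derivative_def)
    have "((\<lambda>s. f t (f s x)) has_derivative (\<lambda>h. D (h *\<^sub>R V x))) (at 0)"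
      using diff_chain_at[OF D0, of "f t" D] \<open>(f t has_derivative D) (at x)\<close>
      by (simp add: comp_def)
    then show "((\<lambda>s. f t (f s x)) has_vector_derivative D (V x)) (at 0)"
      using linear_scale[OF has_derivative_linear[OF \<open>(f t has_derivative D) (at x)\<close>]]
      by (simp add: has_vector_derivative_def)
    have "f t (f s x) = f s (f t x)" for s
      by (simp add: flow_add[symmetric] add.commute)
    then show "((\<lambda>s. f t (f s x)) has_vector_derivative V (f t x)) (at 0)"
      using flow_deriv[of "f t x" 0] by simp
  qed
  ultimately show thesis by (rule that)
qed

lemma frechet_derivative_flow_field: "frechet_derivative (f t) (at x) (V x) = V (f t x)"
proof -
  obtain D where D: "(f t has_derivative D) (at x)" "D (V x) = V (f t x)"
    by (rule flow_space_derivative)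
  then show ?thesis using frechet_derivative_at[OF D(1)] by simp
qed

text \<open>The derivative of the flow carries \<open>V q = 0\<close> to
  \<open>V (f t q) = 0\<close>, so the orbit of \<open>q\<close> has velocity zero
  throughout.\<close>

lemma flow_equilibrium:
  assumes "V q = 0"
  shows "f t q = q"
proof -
  have "V (f t q) = 0" for t
  proof -
    obtain D where D: "(f t has_derivative D) (at q)" "D (V q) = V (f t q)"
      by (rule flow_space_derivative)
    then show ?thesis using linear_0[OF has_derivative_linear[OF D(1)]] assms by simp
  qed
  then have "((\<lambda>s. f s q) has_vector_derivative 0) (at t within UNIV)" for t
    using flow_deriv[of q t] by simp
  then obtain c where "\<And>t. f t q = c"
    using has_vector_derivative_zero_constant[of UNIV "\<lambda>s. f s q"] by auto
  then show ?thesis using flow_0[of q] by simp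
qed

lemma flow_equilibrium_unreachable:
  assumes "V q = 0" "f t x = q"
  shows "x = q"
  using flow_inverse(1)[of t x] flow_equilibrium[OF assms(1), of "- t"] assms(2) by simp

lemma orbit_limit_shift:
  "((\<lambda>t. f t x) \<longlongrightarrow> l) at_top \<Longrightarrow> ((\<lambda>t. f t (f r x)) \<longlongrightarrow> l) at_top"
  "((\<lambda>t. f t x) \<longlongrightarrow> l) at_bot \<Longrightarrow> ((\<lambda>t. f t (f r x)) \<longlongrightarrow> l) at_bot"
proof -
  have "filterlim (\<lambda>t. t + r) at_top at_top"
    unfolding filterlim_at_top eventually_at_top_linorder
    by (metis diff_le_eq)
  then show "((\<lambda>t. f t x) \<longlongrightarrow> l) at_top \<Longrightarrow> ((\<lambda>t. f t (f r x)) \<longlongrightarrow> l) at_top"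
    using filterlim_compose[of "\<lambda>t. f t x" "nhds l" at_top] by (simp add: flow_add[symmetric])
  have "filterlim (\<lambda>t. t + r) at_bot at_bot"
    unfolding filterlim_at_bot eventually_at_bot_linorder
    by (metis le_diff_eq)
  then show "((\<lambda>t. f t x) \<longlongrightarrow> l) at_bot \<Longrightarrow> ((\<lambda>t. f t (f r x)) \<longlongrightarrow> l) at_bot"
    using filterlim_compose[of "\<lambda>t. f t x" "nhds l" at_bot] by (simp add: flow_add[symmetric])
qed

lemma flow_locally_Lipschitz:
  "\<exists>d>0. \<exists>K\<ge>0. \<forall>y\<in>ball x d. norm (f t y - f t x) \<le> K * norm (y - x)"
proof -
  obtain d K where d: "d > 0"
    "\<And>y z. y \<in> ball (t, x) d \<Longrightarrow> z \<in> ball (t, x) d \<Longrightarrow>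
      norm ((\<lambda>(t, x). f t x) y - (\<lambda>(t, x). f t x) z) \<le> K * norm (y - z)"
    using C1_map_locally_Lipschitz[of "\<lambda>(t, x). f t x" "(t, x)"] smooth
    unfolding smooth_flow_def by blast
  have "norm (f t y - f t x) \<le> \<bar>K\<bar> * norm (y - x)" if "y \<in> ball x d" for y
  proof -
    have "norm (f t y - f t x) \<le> K * norm (y - x)"
      using d(2)[of "(t, y)" "(t, x)"] that d(1) by (simp add: dist_Pair_Pair norm_Pair)
    also have "\<dots> \<le> \<bar>K\<bar> * norm (y - x)" by (intro mult_right_mono) auto
    finally show ?thesis .
  qed
  then show ?thesis using d(1) by (intro exI[of _ d] conjI exI[of _ "\<bar>K\<bar>"]) auto
qed

end

section \<open>Returns and escapes of an orbit, read off its omega-limit set\<close>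

lemma omega_limit_frequently:
  fixes f :: "real \<Rightarrow> 'a::metric_space \<Rightarrow> 'a"
  assumes "y \<in> omega_limit_set f x" "0 < e"
  obtains t where "N \<le> t" "dist (f t x) y < e"
proof -
  obtain \<tau> where \<tau>: "filterlim \<tau> at_top sequentially" "(\<lambda>n::nat. f (\<tau> n) x) \<longlonglongrightarrow> y"
    using assms(1) unfolding omega_limit_set_def by blast
  have "eventually (\<lambda>n. N \<le> \<tau> n \<and> dist (f (\<tau> n) x) y < e) sequentially"
    using \<tau>(1) tendstoD[OF \<tau>(2) assms(2)]
    by (auto simp: filterlim_at_top eventually_conj_iff)
  from eventually_happens'[OF sequentially_bot this] show thesis using that by blast
qed

text \<open>Otherwise the orbit visits \<open>K\<close> at arbitrarily late times, and compactness
  yields an omega-limit point in \<open>K\<close>.\<close>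

lemma eventually_outside_compact:
  fixes f :: "real \<Rightarrow> 'a::metric_space \<Rightarrow> 'a"
  assumes "compact K" "omega_limit_set f x \<inter> K = {}"
  obtains N where "\<And>t. N \<le> t \<Longrightarrow> f t x \<notin> K"
proof (rule ccontr)
  assume "\<not> thesis"
  then have "\<forall>n::nat. \<exists>t. real n \<le> t \<and> f t x \<in> K" using that by blast
  then obtain \<tau> where \<tau>: "\<And>n. real n \<le> \<tau> n" "\<And>n. f (\<tau> n) x \<in> K" by metis
  then obtain l r where l: "l \<in> K" "strict_mono (r :: nat \<Rightarrow> nat)" "((\<lambda>n. f (\<tau> n) x) \<circ> r) \<longlonglongrightarrow> l"
    using seq_compactE[of K "\<lambda>n. f (\<tau> n) x"] assms(1) compact_imp_seq_compact by blast
  have "filterlim \<tau> at_top sequentially"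
    by (rule filterlim_at_top_mono[OF filterlim_real_sequentially]) (use \<tau>(1) in auto)
  then have "filterlim (\<tau> \<circ> r) at_top sequentially"
    unfolding comp_def by (rule filterlim_compose) (rule filterlim_subseq[OF l(2)])
  then have "l \<in> omega_limit_set f x"
    using l(3) unfolding omega_limit_set_def comp_def by blast
  then show False using l(1) assms(2) by blast
qed

section \<open>Linear charts at a saddle\<close>

lemma nonpos_if_le_exp_decay:
  fixes r :: real
  assumes "0 < c" "\<And>T. 0 \<le> T \<Longrightarrow> r \<le> K * exp (- c * T)"
  shows "r \<le> 0"
proof (rule tendsto_lowerbound)
  have "((\<lambda>T. exp (- (c * T))) \<longlongrightarrow> 0) at_top"
    using assms(1) by (intro filterlim_compose[OF exp_at_bot] filterlim_compose[OF filterlim_uminus_at_bot_at_top]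
      filterlim_tendsto_pos_mult_at_top[OF tendsto_const] filterlim_ident)
  then show "((\<lambda>T. K * exp (- c * T)) \<longlongrightarrow> 0) at_top"
    using tendsto_mult_right_zero by auto
  show "eventually (\<lambda>T. r \<le> K * exp (- c * T)) at_top"
    by (rule eventually_mono[OF eventually_ge_at_top[of 0]]) (rule assms(2))
qed simp

definition coord_box :: "('a::ab_group_add \<Rightarrow> real) \<Rightarrow> ('a \<Rightarrow> real) \<Rightarrow> 'a \<Rightarrow> real \<Rightarrow> 'a set" where
  "coord_box u s p h = {x. \<bar>u (x - p)\<bar> \<le> h \<and> \<bar>s (x - p)\<bar> \<le> h}"

text \<open>\<open>u\<close> and \<open>s\<close> are meant as linear coordinates along the
  expanding and the contracting eigenvector. The estimates compare \<open>V\<close> at two arbitrary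
  points of the box, so they give a perturbed linear equation for the difference of any two orbits
  in it.\<close>

locale saddle_chart = c1_flow f V for f :: "real \<Rightarrow> 'a::euclidean_space \<Rightarrow> 'a" and V +
  fixes p :: 'a and a b e h0 C :: real and u s :: "'a \<Rightarrow> real"
  assumes V_p: "V p = 0" and lin_u: "bounded_linear u" and lin_s: "bounded_linear s"
    and C_pos: "0 < C" and norm_le_coords: "\<And>w. norm w \<le> C * max \<bar>u w\<bar> \<bar>s w\<bar>"
    and e_pos: "0 < e" and e_a: "2 * e < a" and e_b: "2 * e < b" and h0_pos: "0 < h0"
    and est_u: "\<And>x y. x \<in> coord_box u s p h0 \<Longrightarrow> y \<in> coord_box u s p h0 \<Longrightarrow>
      \<bar>u (V x - V y) - a * u (x - y)\<bar> \<le> e * max \<bar>u (x - y)\<bar> \<bar>s (x - y)\<bar>"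
    and est_s: "\<And>x y. x \<in> coord_box u s p h0 \<Longrightarrow> y \<in> coord_box u s p h0 \<Longrightarrow>
      \<bar>s (V x - V y) + b * s (x - y)\<bar> \<le> e * max \<bar>u (x - y)\<bar> \<bar>s (x - y)\<bar>"
begin

abbreviation "sbox \<equiv> coord_box u s p"

sublocale u: bounded_linear u by (rule lin_u)
sublocale s: bounded_linear s by (rule lin_s)

lemma box_mono: "h \<le> k \<Longrightarrow> x \<in> sbox h \<Longrightarrow> x \<in> sbox k"
  by (auto simp: coord_box_def)

lemma p_in_box: "0 \<le> h \<Longrightarrow> p \<in> sbox h"
  by (simp add: coord_box_def u.zero s.zero)

lemma eq_p_iff_coords: "x = p \<longleftrightarrow> u (x - p) = 0 \<and> s (x - p) = 0"
  using norm_le_coords[of "x - p"] by (auto simp: u.zero s.zero)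

lemma flow_p: "f t p = p"
  by (rule flow_equilibrium) (rule V_p)

lemma eventually_in_box:
  assumes "0 < h" "(g \<longlongrightarrow> p) F"
  shows "eventually (\<lambda>t. g t \<in> sbox h) F"
proof -
  have "((\<lambda>t. \<bar>u (g t - p)\<bar>) \<longlongrightarrow> \<bar>u (p - p)\<bar>) F" "((\<lambda>t. \<bar>s (g t - p)\<bar>) \<longlongrightarrow> \<bar>s (p - p)\<bar>) F"
    by (intro tendsto_intros u.tendsto s.tendsto assms)+
  then have "eventually (\<lambda>t. \<bar>u (g t - p)\<bar> < h) F" "eventually (\<lambda>t. \<bar>s (g t - p)\<bar> < h) F"
    using assms(1) by (auto simp: u.zero s.zero intro: order_tendstoD(2))
  then show ?thesis by eventually_elim (simp add: coord_box_def)
qed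

lemma continuous_on_coords: "continuous_on A (\<lambda>x. \<bar>u (x - q)\<bar>)" "continuous_on A (\<lambda>x. \<bar>s (x - q)\<bar>)"
  by (intro continuous_intros u.continuous_on s.continuous_on)+

lemma closed_box: "closed (sbox h)"
  unfolding coord_box_def
  by (intro closed_Collect_conj closed_Collect_le continuous_on_coords continuous_on_const)

lemma norm_le_box: "x \<in> sbox h \<Longrightarrow> norm (x - p) \<le> C * h"
  using order_trans[OF norm_le_coords[of "x - p"] mult_left_mono[of "max \<bar>u (x - p)\<bar> \<bar>s (x - p)\<bar>" h C]]
    C_pos by (simp add: coord_box_def)

lemma compact_box: "compact (sbox h)"
proof -
  have "sbox h \<subseteq> cball p (C * h)"
    using norm_le_box by (auto simp: dist_norm norm_minus_commute)
  then show ?thesis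
    using closed_box bounded_subset[OF bounded_cball] by (auto simp: compact_eq_bounded_closed)
qed

lemma coords_flow_deriv:
  "((\<lambda>t. u (f t x - f t y)) has_real_derivative u (V (f t x) - V (f t y))) (at t)"
  "((\<lambda>t. s (f t x - f t y)) has_real_derivative s (V (f t x) - V (f t y))) (at t)"
  unfolding has_real_derivative_iff_has_vector_derivative
  by (intro u.has_vector_derivative s.has_vector_derivative has_vector_derivative_diff flow_deriv)+

lemma orbit_difference:
  assumes "t0 \<le> t1" "h \<le> h0"
    and "\<And>t. t0 \<le> t \<Longrightarrow> t \<le> t1 \<Longrightarrow> f t x \<in> sbox h"
    and "\<And>t. t0 \<le> t \<Longrightarrow> t \<le> t1 \<Longrightarrow> f t y \<in> sbox h"
  shows "perturbed_saddle (\<lambda>t. u (f t x - f t y)) (\<lambda>t. s (f t x - f t y))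
    (\<lambda>t. u (V (f t x) - V (f t y))) (\<lambda>t. s (V (f t x) - V (f t y))) a b e t0 t1"
  by unfold_locales
    (use assms e_pos e_a e_b coords_flow_deriv est_u est_s box_mono in \<open>auto\<close>)

text \<open>The equilibrium \<open>p\<close> serves as the second orbit in
  \<open>orbit_difference\<close>.\<close>

lemma orbit_perturbed_saddle:
  assumes "t0 \<le> t1" "h \<le> h0" and "\<And>t. t0 \<le> t \<Longrightarrow> t \<le> t1 \<Longrightarrow> f t x \<in> sbox h"
  shows "perturbed_saddle (\<lambda>t. u (f t x - p)) (\<lambda>t. s (f t x - p))
    (\<lambda>t. u (V (f t x))) (\<lambda>t. s (V (f t x))) a b e t0 t1"
proof -
  have "0 \<le> h" using assms(3)[of t0] assms(1) by (auto simp: coord_box_def)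
  then show ?thesis
    using orbit_difference[OF assms, of p] by (simp add: flow_p V_p p_in_box)
qed

text \<open>The hypothesis \<open>u x = u y\<close> puts the difference of the two orbits in the stable cone at time
  \<open>0\<close>, hence at all earlier times.\<close>

lemma contraction_at_exit:
  assumes T: "0 \<le> T" and h: "h \<le> h0"
    and x: "\<And>t. - T \<le> t \<Longrightarrow> t \<le> 0 \<Longrightarrow> f t x \<in> sbox h"
    and y: "\<And>t. - T \<le> t \<Longrightarrow> t \<le> 0 \<Longrightarrow> f t y \<in> sbox h"
    and u: "u x = u y"
  shows "norm (x - y) \<le> C * (2 * h) * exp (- (b - e) * T)"
proof -
  interpret perturbed_saddle "\<lambda>t. u (f t x - f t y)" "\<lambda>t. s (f t x - f t y)"
    "\<lambda>t. u (V (f t x) - V (f t y))" "\<lambda>t. s (V (f t x) - V (f t y))" a b e "- T" 0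
    by (rule orbit_difference[OF _ h x y]) (use T in auto)
  have "s (f (- T) x - f (- T) y) = s (f (- T) x - p) - s (f (- T) y - p)"
    by (simp add: s.diff)
  then have "\<bar>s (f (- T) x - f (- T) y)\<bar> \<le> 2 * h"
    using x[of "- T"] y[of "- T"] T by (auto simp: coord_box_def)
  then have "\<bar>s (f (- T) x - f (- T) y)\<bar> * exp (- (b - e) * T) \<le> 2 * h * exp (- (b - e) * T)"
    by (intro mult_right_mono) auto
  moreover have "\<bar>s (x - y)\<bar> \<le> \<bar>s (f (- T) x - f (- T) y)\<bar> * exp (- (b - e) * T)"
    using stable_cone_decay u by (simp add: u.diff)
  ultimately have "\<bar>s (x - y)\<bar> \<le> 2 * h * exp (- (b - e) * T)" by linarith
  then have "C * \<bar>s (x - y)\<bar> \<le> C * (2 * h * exp (- (b - e) * T))"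
    using C_pos by (intro mult_left_mono) auto
  moreover have "norm (x - y) \<le> C * \<bar>s (x - y)\<bar>"
    using norm_le_coords[of "x - y"] u by (simp add: u.diff)
  ultimately show ?thesis by (simp add: mult.assoc)
qed

text \<open>It is used as a lower bound on the time that two orbits need to separate.\<close>

lemma expansion_bound:
  assumes T: "0 \<le> T"
    and x: "\<And>t. 0 \<le> t \<Longrightarrow> t \<le> T \<Longrightarrow> f t x \<in> sbox h0"
    and z: "\<And>t. 0 \<le> t \<Longrightarrow> t \<le> T \<Longrightarrow> f t z \<in> sbox h0"
  shows "\<bar>u (f T x - f T z)\<bar> \<le> (\<bar>u (x - z)\<bar> + \<bar>s (x - z)\<bar>) * exp ((a + 2 * e) * T)"
proof -
  interpret perturbed_saddle "\<lambda>t. u (f t x - f t z)" "\<lambda>t. s (f t x - f t z)"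
    "\<lambda>t. u (V (f t x) - V (f t z))" "\<lambda>t. s (V (f t x) - V (f t z))" a b e 0 T
    by (rule orbit_difference[OF _ order_refl x z]) (use T in auto)
  have "(u (f T x - f T z))\<^sup>2 \<le> ((u (x - z))\<^sup>2 + (s (x - z))\<^sup>2) * exp (2 * (a + 2 * e) * T)"
    using order_trans[OF _ energy_bound, of "(u (f T x - f T z))\<^sup>2"] by simp
  also have "\<dots> \<le> (\<bar>u (x - z)\<bar> + \<bar>s (x - z)\<bar>)\<^sup>2 * exp (2 * (a + 2 * e) * T)"
    by (intro mult_right_mono) (auto simp: power2_sum)
  also have "\<dots> = ((\<bar>u (x - z)\<bar> + \<bar>s (x - z)\<bar>) * exp ((a + 2 * e) * T))\<^sup>2"
    by (simp add: power_mult_distrib exp_double[symmetric] mult.assoc)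
  finally show ?thesis
    using abs_le_square_iff[of "u (f T x - f T z)" "(\<bar>u (x - z)\<bar> + \<bar>s (x - z)\<bar>) * exp ((a + 2 * e) * T)"]
    by simp
qed

lemma speed_bound:
  assumes "x \<in> sbox h0"
  shows "norm (V x) \<le> C * ((a + b + e) * max \<bar>u (x - p)\<bar> \<bar>s (x - p)\<bar>)"
proof -
  define m where "m = max \<bar>u (x - p)\<bar> \<bar>s (x - p)\<bar>"
  have "\<bar>u (V x) - a * u (x - p)\<bar> \<le> e * m" "\<bar>s (V x) + b * s (x - p)\<bar> \<le> e * m"
    using est_u[OF assms p_in_box] est_s[OF assms p_in_box] h0_pos by (simp_all add: V_p m_def)
  moreover have "\<bar>a * u (x - p)\<bar> \<le> a * m" "\<bar>b * s (x - p)\<bar> \<le> b * m"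
    using e_pos e_a e_b by (auto simp: abs_mult m_def intro!: mult_left_mono)
  moreover have "0 \<le> a * m" "0 \<le> b * m" using e_pos e_a e_b by (auto simp: m_def)
  ultimately have "max \<bar>u (V x)\<bar> \<bar>s (V x)\<bar> \<le> a * m + b * m + e * m" by linarith
  then have "C * max \<bar>u (V x)\<bar> \<bar>s (V x)\<bar> \<le> C * (a * m + b * m + e * m)"
    using C_pos by (intro mult_left_mono) auto
  then show ?thesis
    using norm_le_coords[of "V x"] by (simp add: algebra_simps m_def)
qed

text \<open>The rate \<open>e\<close> is admissible in \<open>perturbed_saddle_midpoint\<close>
  because \<open>2 * e < a\<close> and \<open>2 * e < b\<close>. What matters is that the speed is
  exponentially small in \<open>T\<close>.\<close>

lemma speed_at_midpoint:
  assumes T: "0 \<le> T" and h: "h \<le> h0" and x: "\<And>t. 0 \<le> t \<Longrightarrow> t \<le> T \<Longrightarrow> f t x \<in> sbox h"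
  shows "norm (V (f (T / 2) x)) \<le> C * ((a + b + e) * (h * exp (- e * (T / 2))))"
proof -
  have "max \<bar>u (f ((0 + T) / 2) x - p)\<bar> \<bar>s (f ((0 + T) / 2) x - p)\<bar> \<le> h * exp (- e * ((T - 0) / 2))"
    by (rule perturbed_saddle_midpoint[OF orbit_perturbed_saddle[OF T h x]])
      (use x e_a e_b e_pos in \<open>auto simp: coord_box_def\<close>)
  then have "C * ((a + b + e) * max \<bar>u (f (T / 2) x - p)\<bar> \<bar>s (f (T / 2) x - p)\<bar>)
      \<le> C * ((a + b + e) * (h * exp (- e * (T / 2))))"
    using C_pos e_pos e_a e_b by (intro mult_left_mono) auto
  moreover have "f (T / 2) x \<in> sbox h0" using x[of "T / 2"] T h box_mono by simp
  ultimately show ?thesis using speed_bound[of "f (T / 2) x"] by linarith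
qed

text \<open>The stable cone persists backward, so \<open>s\<close> has been contracting, from a
  value at most \<open>h\<close>, for an arbitrarily long time. Hence it vanishes, and
  \<open>u\<close> with it.\<close>

lemma backward_in_box_stable_cone_eq:
  assumes h: "h \<le> h0" and x: "\<And>t. t \<le> 0 \<Longrightarrow> f t x \<in> sbox h" and cone: "\<bar>u (x - p)\<bar> \<le> \<bar>s (x - p)\<bar>"
  shows "x = p"
proof -
  have "\<bar>s (x - p)\<bar> \<le> h * exp (- (b - e) * T)" if "0 \<le> T" for T
  proof -
    interpret perturbed_saddle "\<lambda>t. u (f t x - p)" "\<lambda>t. s (f t x - p)"
      "\<lambda>t. u (V (f t x))" "\<lambda>t. s (V (f t x))" a b e "- T" 0
      by (rule orbit_perturbed_saddle[OF _ h x]) (use that in auto)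
    have "\<bar>s (x - p)\<bar> \<le> \<bar>s (f (- T) x - p)\<bar> * exp (- (b - e) * T)"
      using stable_cone_decay cone by simp
    also have "\<dots> \<le> h * exp (- (b - e) * T)"
      using x[of "- T"] that by (intro mult_right_mono) (auto simp: coord_box_def)
    finally show ?thesis .
  qed
  then have "\<bar>s (x - p)\<bar> \<le> 0"
    using e_b e_pos by (intro nonpos_if_le_exp_decay[of "b - e"]) auto
  then show ?thesis using cone by (simp add: eq_p_iff_coords)
qed

lemma forward_in_box_unstable_cone_eq:
  assumes h: "h \<le> h0" and x: "\<And>t. 0 \<le> t \<Longrightarrow> f t x \<in> sbox h" and cone: "\<bar>s (x - p)\<bar> \<le> \<bar>u (x - p)\<bar>"
  shows "x = p"
proof -
  have "\<bar>u (x - p)\<bar> \<le> h * exp (- (a - e) * T)" if "0 \<le> T" for T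
  proof -
    interpret perturbed_saddle "\<lambda>t. u (f t x - p)" "\<lambda>t. s (f t x - p)"
      "\<lambda>t. u (V (f t x))" "\<lambda>t. s (V (f t x))" a b e 0 T
      by (rule orbit_perturbed_saddle[OF _ h x]) (use that in auto)
    have "\<bar>u (x - p)\<bar> \<le> \<bar>u (f T x - p)\<bar> * exp (- (a - e) * T)"
      using unstable_cone_growth cone by simp
    also have "\<dots> \<le> h * exp (- (a - e) * T)"
      using x[of T] that by (intro mult_right_mono) (auto simp: coord_box_def)
    finally show ?thesis .
  qed
  then have "\<bar>u (x - p)\<bar> \<le> 0"
    using e_a e_pos by (intro nonpos_if_le_exp_decay[of "a - e"]) auto
  then show ?thesis using cone by (simp add: eq_p_iff_coords)
qed

text \<open>An orbit cannot leave through a face where \<open>s\<close> has modulus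
  \<open>h\<close>, since the contraction pushes it inwards there. The hypothesis on
  \<open>u\<close> excludes the other faces.\<close>

lemma stays_in_box_shortly:
  assumes h: "0 < h" "h \<le> h0" and x: "x \<in> sbox h" and u: "\<bar>u (x - p)\<bar> < h"
  shows "\<exists>d>0. \<forall>t. 0 \<le> t \<longrightarrow> t < d \<longrightarrow> f t x \<in> sbox h"
proof -
  have lim: "((\<lambda>t. \<bar>u (f t x - p)\<bar>) \<longlongrightarrow> \<bar>u (x - p)\<bar>) (at 0)"
    "((\<lambda>t. \<bar>s (f t x - p)\<bar>) \<longlongrightarrow> \<bar>s (x - p)\<bar>) (at 0)"
    using flow_tendsto[of x 0] by (auto intro!: tendsto_intros u.tendsto s.tendsto)
  have "\<exists>d>0. \<forall>t. dist t 0 < d \<longrightarrow> t \<noteq> 0 \<longrightarrow> \<bar>u (f t x - p)\<bar> < h"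
    using order_tendstoD(2)[OF lim(1) u] by (auto simp: eventually_at)
  then obtain d1 where d1: "d1 > 0" "\<And>t. \<bar>t\<bar> < d1 \<Longrightarrow> \<bar>u (f t x - p)\<bar> < h"
    using u by (auto simp: dist_norm) (metis flow_0)
  have "\<exists>d>0. \<forall>t>0. t < d \<longrightarrow> \<bar>s (f t x - p)\<bar> \<le> h"
  proof (cases "\<bar>s (x - p)\<bar> < h")
    case True
    then obtain d where "d > 0" "\<And>t. t \<noteq> 0 \<Longrightarrow> \<bar>t\<bar> < d \<Longrightarrow> \<bar>s (f t x - p)\<bar> < h"
      using order_tendstoD(2)[OF lim(2) True] by (auto simp: eventually_at dist_norm)
    then show ?thesis by (intro exI[of _ d]) (auto intro: less_imp_le)
  next
    case False
    then have s: "\<bar>s (x - p)\<bar> = h" using x by (auto simp: coord_box_def)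
    \<comment> \<open>The interval is the single time 0: only the derivative estimates there are
      wanted.\<close>
    interpret perturbed_saddle "\<lambda>t. u (f t x - p)" "\<lambda>t. s (f t x - p)"
      "\<lambda>t. u (V (f t x))" "\<lambda>t. s (V (f t x))" a b e 0 0
      by (rule orbit_perturbed_saddle[OF _ h(2)]) (use x in auto)
    have "max \<bar>u (x - p)\<bar> \<bar>s (x - p)\<bar> = h" using u s by simp
    then have "s (x - p) * s (V x) \<le> - (b * (s (x - p))\<^sup>2) + e * h\<^sup>2"
      using product_bounds(3)[of 0] by simp
    moreover have "b * (s (x - p))\<^sup>2 = b * h\<^sup>2" using s by (metis power2_abs)
    moreover have "e * h\<^sup>2 < b * h\<^sup>2" using e_b e_pos h by (intro mult_strict_right_mono) auto
    ultimately have neg: "2 * s (x - p) * s (V x) < 0" by linarith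
    have "((\<lambda>t. (s (f t x - p))\<^sup>2) has_real_derivative 2 * s (x - p) * s (V x)) (at 0)"
      by (auto intro!: derivative_eq_intros DS[of 0])
    from has_real_derivative_neg_dec_right[OF this neg]
    obtain d where d: "d > 0" "\<And>t. 0 < t \<Longrightarrow> t < d \<Longrightarrow> (s (f t x - p))\<^sup>2 < (s (x - p))\<^sup>2"
      by auto
    have "\<bar>s (f t x - p)\<bar> \<le> h" if "0 < t" "t < d" for t
      using d(2)[OF that] s by (metis abs_le_square_iff less_imp_le)
    then show ?thesis using d(1) by blast
  qed
  then obtain d2 where d2: "d2 > 0" "\<And>t. 0 < t \<Longrightarrow> t < d2 \<Longrightarrow> \<bar>s (f t x - p)\<bar> \<le> h" by blast
  have "f t x \<in> sbox h" if "0 \<le> t" "t < min d1 d2" for t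
  proof (cases "t = 0")
    case False
    then show ?thesis using d1(2)[of t] d2(2)[of t] that by (auto simp: coord_box_def)
  qed (use x in simp)
  then show ?thesis using d1(1) d2(1) by (intro exI[of _ "min d1 d2"]) auto
qed

text \<open>\<open>T\<close> is the supremum of the times up to which the orbit stays in the box.
  Closedness keeps it in the box at \<open>T\<close>, and a smaller \<open>u\<close> coordinate
  would allow a longer stay by \<open>stays_in_box_shortly\<close>.\<close>

lemma exit_from_box:
  assumes h: "0 < h" "h \<le> h0" and x: "x \<in> sbox h" and out: "0 \<le> t2" "f t2 x \<notin> sbox h"
  obtains T where "0 \<le> T" "\<And>t. 0 \<le> t \<Longrightarrow> t \<le> T \<Longrightarrow> f t x \<in> sbox h" "\<bar>u (f T x - p)\<bar> = h"
proof -
  define A where "A = {t. 0 \<le> t \<and> (\<forall>r. 0 \<le> r \<longrightarrow> r \<le> t \<longrightarrow> f r x \<in> sbox h)}"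
  define T where "T = Sup A"
  have A0: "0 \<in> A" using x by (auto simp: A_def)
  have bdd: "bdd_above A"
    using out by (intro bdd_aboveI[of _ t2]) (force simp: A_def)
  have T0: "0 \<le> T" unfolding T_def by (rule cSup_upper[OF A0 bdd])
  have less: "f r x \<in> sbox h" if "0 \<le> r" "r < T" for r
    using less_cSup_iff[of A r] A0 bdd that by (force simp: A_def T_def)
  have "f T x \<in> sbox h"
  proof (cases "T = 0")
    case False
    then have "T > 0" using T0 by simp
    have "((\<lambda>t. f t x) \<longlongrightarrow> f T x) (at_left T)"
      using flow_tendsto by (rule filterlim_mono) (auto simp: at_le)
    moreover have "eventually (\<lambda>t. f t x \<in> sbox h) (at_left T)"
      using eventually_at_left_real[OF \<open>T > 0\<close>] by eventually_elim (auto intro: less)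
    ultimately show ?thesis
      by (intro Lim_in_closed_set[OF closed_box]) auto
  qed (use x in simp)
  with less have le: "f r x \<in> sbox h" if "0 \<le> r" "r \<le> T" for r
    using that by (cases "r = T") auto
  have "\<not> \<bar>u (f T x - p)\<bar> < h"
  proof
    assume "\<bar>u (f T x - p)\<bar> < h"
    then obtain d where d: "d > 0" "\<And>t. 0 \<le> t \<Longrightarrow> t < d \<Longrightarrow> f t (f T x) \<in> sbox h"
      using stays_in_box_shortly[OF h \<open>f T x \<in> sbox h\<close>] by blast
    have "f r x \<in> sbox h" if "0 \<le> r" "r \<le> T + d / 2" for r
    proof (cases "r \<le> T")
      case False
      then show ?thesis
        using d(2)[of "r - T"] d(1) that flow_add[of "r - T" T x] by simp
    qed (use le that in simp)
    then have "T + d / 2 \<in> A" using T0 d(1) by (auto simp: A_def)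
    then have "T + d / 2 \<le> T" unfolding T_def by (rule cSup_upper[OF _ bdd])
    then show False using d(1) by simp
  qed
  then have "\<bar>u (f T x - p)\<bar> = h" using le[of T] T0 by (auto simp: coord_box_def)
  then show thesis using that T0 le by blast
qed

text \<open>After some late time the curve is close to \<open>q\<close> and hence away from
  \<open>p\<close>; on the remaining compact interval its distance from \<open>p\<close>, measured
  in the coordinates, has a positive minimum.\<close>

lemma avoids_box_forward:
  fixes g :: "real \<Rightarrow> 'a"
  assumes cont: "continuous_on UNIV g" and lim: "(g \<longlongrightarrow> q) at_top" and q: "q \<noteq> p"
    and g: "\<And>t. g t \<noteq> p"
  shows "\<exists>k>0. \<forall>t\<ge>t0. g t \<notin> sbox k"
proof -
  define m where "m x = max \<bar>u (x - p)\<bar> \<bar>s (x - p)\<bar>" for x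
  have m_pos: "0 < m x" if "x \<noteq> p" for x
    using that eq_p_iff_coords[of x] by (auto simp: m_def less_max_iff_disj)
  have m_box: "x \<notin> sbox k" if "k < m x" for x k
    using that by (auto simp: m_def coord_box_def)
  have "open (- sbox (m q / 2))" "q \<in> - sbox (m q / 2)"
    using closed_box m_pos[OF q] m_box[of "m q / 2" q] by auto
  from topological_tendstoD[OF lim this]
  obtain T where T: "\<And>t. T \<le> t \<Longrightarrow> g t \<notin> sbox (m q / 2)"
    unfolding eventually_at_top_linorder by blast
  define T' where "T' = max t0 T"
  have "continuous_on {t0..T'} (\<lambda>t. m (g t))"
    unfolding m_def using continuous_on_subset[OF cont subset_UNIV]
    by (intro continuous_intros u.continuous_on s.continuous_on)
  then obtain tm where tm: "tm \<in> {t0..T'}" "\<And>t. t \<in> {t0..T'} \<Longrightarrow> m (g tm) \<le> m (g t)"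
    using continuous_attains_inf[of "{t0..T'}" "\<lambda>t. m (g t)"] by (auto simp: T'_def)
  define k where "k = min (m q / 2) (m (g tm) / 2)"
  have "k > 0" using m_pos[OF q] m_pos[OF g] by (simp add: k_def)
  moreover have "g t \<notin> sbox k" if "t0 \<le> t" for t
  proof (cases "t \<le> T'")
    case True
    then have "m (g tm) \<le> m (g t)" using tm(2) that by simp
    then show ?thesis using m_pos[OF g, of tm] by (intro m_box) (simp add: k_def min_def)
  next
    case False
    then have "g t \<notin> sbox (m q / 2)" by (intro T) (simp add: T'_def)
    then show ?thesis using box_mono[of k "m q / 2"] by (auto simp: k_def)
  qed
  ultimately show ?thesis by blast
qed

end

section \<open>Passages near a saddle\<close>

text \<open>\<open>y\<close> is the point where the outgoing connection crosses an exit face of the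
  box. By \<open>gate\<close> the curve \<gamma> meets the exit faces nowhere else, so an orbit with
  limit set \<gamma> leaves the box near \<open>y\<close> at late times; \<open>leaves\<close>
  forces it to leave at all.\<close>

locale saddle_gate = saddle_chart f V p a b e h0 C u s
  for f :: "real \<Rightarrow> 'a::euclidean_space \<Rightarrow> 'a" and V p a b e h0 C u s +
  fixes h :: real and y :: 'a and \<gamma> :: "'a set"
  assumes h_pos: "0 < h" and h_le: "h \<le> h0" and u_y: "\<bar>u (y - p)\<bar> = h"
    and y_backward: "\<And>t. t \<le> 0 \<Longrightarrow> f t y \<in> coord_box u s p h"
    and gate: "\<And>x. x \<in> \<gamma> \<Longrightarrow> \<bar>u (x - p)\<bar> = h \<Longrightarrow> \<bar>s (x - p)\<bar> \<le> h \<Longrightarrow> x = y"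
    and leaves: "\<exists>q\<in>\<gamma>. q \<notin> coord_box u s p h"
begin

text \<open>The time \<open>t\<close> need not be the time of entry. A passage may begin anywhere in
  the box, in particular very close to \<open>p\<close>.\<close>

definition passage :: "'a \<Rightarrow> real \<Rightarrow> real \<Rightarrow> bool" where
  "passage x t T \<longleftrightarrow> 0 \<le> T \<and> (\<forall>r. t \<le> r \<longrightarrow> r \<le> t + T \<longrightarrow> f r x \<in> sbox h) \<and>
    \<bar>u (f (t + T) x - p)\<bar> = h"

lemma passage_exists:
  assumes om: "omega_limit_set f x = \<gamma>" and x: "f t x \<in> sbox h"
  shows "\<exists>T. passage x t T"
proof -
  obtain q where q: "q \<in> \<gamma>" "q \<in> - sbox h" using leaves by blast
  then obtain d where d: "d > 0" "ball q d \<subseteq> - sbox h"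
    using closed_box open_contains_ball by (metis open_Compl)
  obtain t2 where t2: "t \<le> t2" "dist (f t2 x) q < d"
    using omega_limit_frequently[of q f x d t] om q(1) d(1) by blast
  have "f (t2 - t) (f t x) \<notin> sbox h"
    using t2 d(2) by (auto simp: flow_add[symmetric] dist_commute)
  then obtain T where T: "0 \<le> T" "\<And>r. 0 \<le> r \<Longrightarrow> r \<le> T \<Longrightarrow> f r (f t x) \<in> sbox h"
    "\<bar>u (f T (f t x) - p)\<bar> = h"
    using exit_from_box[OF h_pos h_le x, of "t2 - t"] t2(1) by auto
  have "f r x \<in> sbox h" if "t \<le> r" "r \<le> t + T" for r
    using T(2)[of "r - t"] that by (simp add: flow_add[symmetric])
  then have "passage x t T"
    using T(1,3) by (auto simp: passage_def flow_add[symmetric] add.commute)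
  then show ?thesis ..
qed

text \<open>The points of the exit faces at distance at least \<open>d\<close> from \<open>y\<close>
  form a compact set, which misses the limit set by \<open>gate\<close>.\<close>

lemma exits_near_gate:
  assumes om: "omega_limit_set f x = \<gamma>" and d: "0 < d"
  shows "\<exists>N. \<forall>t\<ge>N. \<bar>u (f t x - p)\<bar> = h \<longrightarrow> \<bar>s (f t x - p)\<bar> \<le> h \<longrightarrow> dist (f t x) y < d"
proof -
  define K where "K = sbox h \<inter> ({x. \<bar>u (x - p)\<bar> = h} \<inter> {x. d \<le> dist x y})"
  have "compact K" unfolding K_def
    by (intro compact_Int_closed compact_box closed_Int closed_Collect_eq closed_Collect_le
        continuous_on_coords continuous_intros)
  moreover have "omega_limit_set f x \<inter> K = {}"
    using gate d om by (auto simp: K_def coord_box_def)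
  ultimately obtain N where "\<And>t. N \<le> t \<Longrightarrow> f t x \<notin> K"
    using eventually_outside_compact by blast
  then show ?thesis
    by (intro exI[of _ N]) (auto simp: K_def coord_box_def not_le[symmetric])
qed

lemma passage_exit:
  assumes om: "omega_limit_set f x = \<gamma>" and d: "0 < d"
  shows "\<exists>N. \<forall>t\<ge>N. \<forall>T. passage x t T \<longrightarrow> dist (f (t + T) x) y < d \<and>
    norm (f (t + T) x - y) \<le> C * (2 * h) * exp (- (b - e) * T)"
proof -
  obtain K where K: "K > 0" "\<And>w. \<bar>u w\<bar> \<le> norm w * K"
    using u.pos_bounded by auto
  obtain N where N: "\<And>t. N \<le> t \<Longrightarrow> \<bar>u (f t x - p)\<bar> = h \<Longrightarrow> \<bar>s (f t x - p)\<bar> \<le> h \<Longrightarrow>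
      dist (f t x) y < min d (h / K)"
    using exits_near_gate[OF om, of "min d (h / K)"] d h_pos K(1) by auto
  have "dist (f (t + T) x) y < d \<and> norm (f (t + T) x - y) \<le> C * (2 * h) * exp (- (b - e) * T)"
    if "N \<le> t" and P: "passage x t T" for t T
  proof -
    define x1 where "x1 = f (t + T) x"
    have T: "0 \<le> T" and box: "\<And>r. t \<le> r \<Longrightarrow> r \<le> t + T \<Longrightarrow> f r x \<in> sbox h"
      and ux1: "\<bar>u (x1 - p)\<bar> = h"
      using P by (auto simp: passage_def x1_def)
    have near: "dist x1 y < min d (h / K)"
      unfolding x1_def
    proof (rule N)
      show "\<bar>u (f (t + T) x - p)\<bar> = h" using ux1 by (simp add: x1_def)
      show "\<bar>s (f (t + T) x - p)\<bar> \<le> h" using box[of "t + T"] T by (simp add: coord_box_def)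
    qed (use that T in simp)
    have "\<bar>u (x1 - y)\<bar> \<le> dist x1 y * K" using K(2) by (simp add: dist_norm)
    also have "\<dots> < h" using near K(1) by (simp add: pos_less_divide_eq)
    finally have "\<bar>u (x1 - p) - u (y - p)\<bar> < h" by (simp add: u.diff)
    \<comment> \<open>Two numbers of modulus \<open>h\<close> that differ by less than
      \<open>h\<close> coincide. The bound \<open>h / K\<close> was chosen for this: it puts the
      exit point on the same face as \<open>y\<close>, as \<open>contraction_at_exit\<close>
      requires.\<close>
    then have "u x1 = u y" using ux1 u_y h_pos by (simp add: u.diff)
    moreover have "f r x1 \<in> sbox h" if "- T \<le> r" "r \<le> 0" for r
      using box[of "r + (t + T)"] that by (simp add: x1_def flow_add[symmetric])
    ultimately have "norm (x1 - y) \<le> C * (2 * h) * exp (- (b - e) * T)"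
      using T h_le y_backward by (intro contraction_at_exit) auto
    then show ?thesis using near by (simp add: x1_def)
  qed
  then show ?thesis by blast
qed

text \<open>The orbit of \<open>z\<close> stays in the half box while that of \<open>x\<close>
  leaves where \<open>u\<close> has modulus \<open>h\<close>, so their \<open>u\<close> coordinates
  then differ by at least \<open>h / 2\<close>. By \<open>expansion_bound\<close> a small initial
  distance makes the passage long.\<close>

lemma passage_duration:
  assumes om: "omega_limit_set f x = \<gamma>" and x: "f t x \<in> sbox h"
    and z: "\<And>t. 0 \<le> t \<Longrightarrow> f t z \<in> sbox (h / 2)"
  shows "\<exists>T. passage x t T \<and>
    h / 2 \<le> (\<bar>u (f t x - z)\<bar> + \<bar>s (f t x - z)\<bar>) * exp ((a + 2 * e) * T)"
proof -
  obtain T where P: "passage x t T" using passage_exists[OF om x] by blast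
  then have T: "0 \<le> T" and box: "\<And>r. t \<le> r \<Longrightarrow> r \<le> t + T \<Longrightarrow> f r x \<in> sbox h"
    and ux: "\<bar>u (f (t + T) x - p)\<bar> = h"
    by (auto simp: passage_def)
  have "f r (f t x) \<in> sbox h0" if "0 \<le> r" "r \<le> T" for r
    using box[of "r + t"] that box_mono[OF h_le] by (simp add: flow_add[symmetric])
  moreover have "f r z \<in> sbox h0" if "0 \<le> r" for r
    using z[OF that] box_mono[of "h / 2" h0] h_le h_pos by simp
  ultimately have "\<bar>u (f T (f t x) - f T z)\<bar> \<le>
      (\<bar>u (f t x - z)\<bar> + \<bar>s (f t x - z)\<bar>) * exp ((a + 2 * e) * T)"
    using T by (intro expansion_bound) auto
  then have "\<bar>u (f (t + T) x - f T z)\<bar> \<le>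
      (\<bar>u (f t x - z)\<bar> + \<bar>s (f t x - z)\<bar>) * exp ((a + 2 * e) * T)"
    by (simp add: flow_add[symmetric] add.commute)
  moreover have "\<bar>u (f T z - p)\<bar> \<le> h / 2" using z[OF T] by (simp add: coord_box_def)
  moreover have "u (f (t + T) x - f T z) = u (f (t + T) x - p) - u (f T z - p)"
    by (simp add: u.diff)
  ultimately have "h / 2 \<le> (\<bar>u (f t x - z)\<bar> + \<bar>s (f t x - z)\<bar>) * exp ((a + 2 * e) * T)"
    using ux by linarith
  with P show ?thesis by blast
qed

text \<open>The orbit comes arbitrarily close to \<open>p\<close>, and
  \<open>passage_duration\<close> is applied with \<open>p\<close> itself as the reference
  orbit.\<close>

lemma long_passages:
  assumes om: "omega_limit_set f x = \<gamma>" and p: "p \<in> \<gamma>"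
  shows "\<exists>t\<ge>N. \<exists>T\<ge>M. passage x t T"
proof -
  \<comment> \<open>With both coordinates at most \<open>k\<close>, a passage shorter than
    \<open>M\<close> would reach at most \<open>h / 4\<close>, short of the \<open>h / 2\<close> of
    \<open>passage_duration\<close>.\<close>
  define k where "k = min h (h / 8 * exp (- ((a + 2 * e) * M)))"
  have "0 < k" using h_pos by (simp add: k_def)
  then have "eventually (\<lambda>w. w \<in> sbox k) (nhds p)"
    using eventually_in_box[of k "\<lambda>w. w" "nhds p"] filterlim_ident by blast
  then obtain d where d: "d > 0" "\<And>w. dist w p < d \<Longrightarrow> w \<in> sbox k"
    by (auto simp: eventually_nhds_metric)
  obtain t where t: "N \<le> t" "dist (f t x) p < d"
    using omega_limit_frequently[of p f x d N] om p d(1) by blast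
  then have box: "f t x \<in> sbox k" using d(2) by blast
  have "f t x \<in> sbox h" using box by (rule box_mono[rotated]) (simp add: k_def)
  moreover have "f t p \<in> sbox (h / 2)" for t
    using h_pos by (simp add: flow_p p_in_box)
  ultimately obtain T where P: "passage x t T"
    and T: "h / 2 \<le> (\<bar>u (f t x - p)\<bar> + \<bar>s (f t x - p)\<bar>) * exp ((a + 2 * e) * T)"
    using passage_duration[OF om, of t p] by blast
  have "M \<le> T"
  proof (rule ccontr)
    assume "\<not> M \<le> T"
    then have "exp ((a + 2 * e) * T) \<le> exp ((a + 2 * e) * M)" using e_pos e_a by simp
    moreover have "\<bar>u (f t x - p)\<bar> + \<bar>s (f t x - p)\<bar> \<le> h / 4 * exp (- ((a + 2 * e) * M))"
      using box by (simp add: coord_box_def k_def)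
    ultimately have "(\<bar>u (f t x - p)\<bar> + \<bar>s (f t x - p)\<bar>) * exp ((a + 2 * e) * T) \<le>
        h / 4 * exp (- ((a + 2 * e) * M)) * exp ((a + 2 * e) * M)"
      using h_pos by (intro mult_mono) auto
    also have "\<dots> = h / 4" by (simp add: exp_minus)
    finally show False using T h_pos by simp
  qed
  then show ?thesis using P t(1) by blast
qed

lemma passage_speed:
  assumes "passage x t T"
  shows "norm (V (f (t + T / 2) x)) \<le> C * ((a + b + e) * (h * exp (- e * (T / 2))))"
proof -
  have "norm (V (f (T / 2) (f t x))) \<le> C * ((a + b + e) * (h * exp (- e * (T / 2))))"
    using assms h_le by (intro speed_at_midpoint) (auto simp: passage_def flow_add[symmetric])
  then show ?thesis by (simp add: flow_add[symmetric] add.commute)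
qed

end

text \<open>\<tau> is a fixed travel time along the connection. The half size leaves room for nearby
  orbits to enter the full box of the next saddle.\<close>

locale heteroclinic_connection =
  P: saddle_gate f V p a b e h0 C u s h y \<gamma> + Q: saddle_gate f V p' a' b' e' h0' C' u' s' h' y' \<gamma>
  for f :: "real \<Rightarrow> 'a::euclidean_space \<Rightarrow> 'a" and V p a b e h0 C u s h y \<gamma>
    and p' a' b' e' h0' C' u' s' h' y' +
  fixes \<tau> :: real
  assumes tail: "\<And>t. \<tau> \<le> t \<Longrightarrow> f t y \<in> coord_box u' s' p' (h' / 2)"
begin

text \<open>Three estimates are chained: the exit point is exponentially close to \<open>y\<close>,
  the flow over time \<tau> is Lipschitz near \<open>y\<close>, and a small distance from
  \<open>z\<close> forces a long passage at the next saddle. Logarithms make this linear in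
  \<open>T\<close> and \<open>T'\<close>.\<close>

lemma transition:
  assumes om: "omega_limit_set f x = \<gamma>"
  shows "\<exists>N c. \<forall>t\<ge>N. \<forall>T. P.passage x t T \<longrightarrow>
    (\<exists>T'. Q.passage x (t + T + \<tau>) T' \<and> (b - e) * T - c \<le> (a' + 2 * e') * T')"
proof -
  define z where "z = f \<tau> y"
  have z: "f t z \<in> Q.sbox (h' / 2)" if "0 \<le> t" for t
    using tail[of "t + \<tau>"] that by (simp add: z_def P.flow_add[symmetric])
  obtain d K where d: "d > 0" "K \<ge> 0" "\<And>w. w \<in> ball y d \<Longrightarrow> norm (f \<tau> w - z) \<le> K * norm (w - y)"
    using P.flow_locally_Lipschitz[of y \<tau>] unfolding z_def by blast
  obtain Ku where Ku: "Ku > 0" "\<And>w. \<bar>u' w\<bar> \<le> norm w * Ku" using Q.u.pos_bounded by auto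
  obtain Ks where Ks: "Ks > 0" "\<And>w. \<bar>s' w\<bar> \<le> norm w * Ks" using Q.s.pos_bounded by auto
  \<comment> \<open>The summand 1 makes \<open>L\<close> positive even if \<open>K\<close> is 0,
    since \<open>L\<close> is divided by below.\<close>
  define L where "L = K * (Ku + Ks) + 1"
  have L_pos: "0 < L" using d(2) Ku(1) Ks(1) by (simp add: L_def add_nonneg_pos)
  have Lip: "\<bar>u' (f \<tau> w - z)\<bar> + \<bar>s' (f \<tau> w - z)\<bar> \<le> L * norm (w - y)" if "w \<in> ball y d" for w
  proof -
    have "\<bar>u' (f \<tau> w - z)\<bar> + \<bar>s' (f \<tau> w - z)\<bar> \<le> norm (f \<tau> w - z) * (Ku + Ks)"
      using Ku(2)[of "f \<tau> w - z"] Ks(2)[of "f \<tau> w - z"] by (simp add: algebra_simps)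
    also have "\<dots> \<le> K * norm (w - y) * (Ku + Ks)"
      using d(3)[OF that] Ku(1) Ks(1) by (intro mult_right_mono) auto
    also have "\<dots> \<le> L * norm (w - y)" by (simp add: L_def algebra_simps)
    finally show ?thesis .
  qed
  \<comment> \<open>The first bound validates the Lipschitz estimate; the second keeps the image
    within \<open>h' / 2\<close> of \<open>z\<close> in each coordinate, hence in the box of size
    \<open>h'\<close>.\<close>
  define \<delta> where "\<delta> = min d (h' / (2 * L))"
  have "0 < \<delta>" using d(1) Q.h_pos L_pos by (simp add: \<delta>_def)
  then obtain N where N: "\<And>t T. N \<le> t \<Longrightarrow> P.passage x t T \<Longrightarrow> dist (f (t + T) x) y < \<delta> \<and>
      norm (f (t + T) x - y) \<le> C * (2 * h) * exp (- (b - e) * T)"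
    using P.passage_exit[OF om] by blast
  define A where "A = L * (C * (2 * h))"
  have A_pos: "0 < A" using L_pos P.C_pos P.h_pos by (simp add: A_def)
  have "\<exists>T'. Q.passage x (t + T + \<tau>) T' \<and>
      (b - e) * T - (ln A - ln (h' / 2)) \<le> (a' + 2 * e') * T'"
    if "N \<le> t" "P.passage x t T" for t T
  proof -
    define w where "w = f (t + T) x"
    have w: "dist w y < \<delta>" "norm (w - y) \<le> C * (2 * h) * exp (- (b - e) * T)"
      using N[OF that] by (simp_all add: w_def)
    have fw: "f (t + T + \<tau>) x = f \<tau> w"
      by (simp add: w_def P.flow_add[symmetric] add_ac)
    have Lw: "\<bar>u' (f \<tau> w - z)\<bar> + \<bar>s' (f \<tau> w - z)\<bar> \<le> L * norm (w - y)"
      using w(1) by (intro Lip) (simp add: \<delta>_def dist_commute)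
    have "L * norm (w - y) \<le> h' / 2"
      using w(1) L_pos by (simp add: \<delta>_def dist_norm field_simps)
    then have "\<bar>u' (f \<tau> w - z)\<bar> \<le> h' / 2" "\<bar>s' (f \<tau> w - z)\<bar> \<le> h' / 2" using Lw by linarith+
    moreover have "\<bar>u' (z - p')\<bar> \<le> h' / 2" "\<bar>s' (z - p')\<bar> \<le> h' / 2"
      using z[of 0] by (auto simp: coord_box_def)
    moreover have "u' (f \<tau> w - p') = u' (f \<tau> w - z) + u' (z - p')"
      "s' (f \<tau> w - p') = s' (f \<tau> w - z) + s' (z - p')"
      by (simp_all add: Q.u.diff Q.s.diff)
    ultimately have "\<bar>u' (f \<tau> w - p')\<bar> \<le> h'" "\<bar>s' (f \<tau> w - p')\<bar> \<le> h'" by linarith+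
    then have box: "f (t + T + \<tau>) x \<in> Q.sbox h'"
      by (simp add: fw coord_box_def)
    have "\<exists>T'. Q.passage x (t + T + \<tau>) T' \<and> h' / 2 \<le>
        (\<bar>u' (f (t + T + \<tau>) x - z)\<bar> + \<bar>s' (f (t + T + \<tau>) x - z)\<bar>) * exp ((a' + 2 * e') * T')"
      by (rule Q.passage_duration[OF om box]) (rule z)
    then obtain T' where P: "Q.passage x (t + T + \<tau>) T'"
      and T': "h' / 2 \<le> (\<bar>u' (f \<tau> w - z)\<bar> + \<bar>s' (f \<tau> w - z)\<bar>) * exp ((a' + 2 * e') * T')"
      unfolding fw by blast
    have "L * norm (w - y) \<le> L * (C * (2 * h) * exp (- (b - e) * T))"
      using w(2) L_pos by (intro mult_left_mono) auto
    then have "(\<bar>u' (f \<tau> w - z)\<bar> + \<bar>s' (f \<tau> w - z)\<bar>) * exp ((a' + 2 * e') * T') \<le>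
        A * exp (- (b - e) * T) * exp ((a' + 2 * e') * T')"
      using Lw by (intro mult_right_mono) (auto simp: A_def mult.assoc)
    then have "h' / 2 \<le> A * exp ((a' + 2 * e') * T' - (b - e) * T)"
      using T' by (simp add: mult.assoc exp_add[symmetric] algebra_simps)
    then have "ln (h' / 2) \<le> ln (A * exp ((a' + 2 * e') * T' - (b - e) * T))"
      using Q.h_pos A_pos by (intro ln_mono) auto
    also have "\<dots> = ln A + ((a' + 2 * e') * T' - (b - e) * T)"
      using A_pos by (subst ln_mult_pos) auto
    finally show ?thesis using P by (intro exI[of _ T']) simp
  qed
  then show ?thesis by blast
qed

end

section \<open>Geometric growth of the passage durations\<close>

text \<open>One loop from \<open>A\<close> to \<open>B\<close> and back multiplies the duration by
  at least \<open>k1 * k2 / (l1 * l2)\<close>, up to a bounded loss. From a long first passage on,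
  durations grow geometrically, so the elapsed time is comparable with the last of them.\<close>

lemma geometric_passage_times:
  fixes A B :: "real \<Rightarrow> real \<Rightarrow> bool"
  assumes AB: "\<exists>N c. \<forall>t\<ge>N. \<forall>T. A t T \<longrightarrow> (\<exists>T'. B (t + T + \<tau>) T' \<and> k1 * T - c \<le> l2 * T')"
    and BA: "\<exists>N c. \<forall>t\<ge>N. \<forall>T. B t T \<longrightarrow> (\<exists>T'. A (t + T + \<sigma>) T' \<and> k2 * T - c \<le> l1 * T')"
    and start: "\<And>M N. \<exists>t\<ge>N. \<exists>T\<ge>M. A t T"
    and nonneg: "\<And>t T. A t T \<Longrightarrow> 0 \<le> T" "\<And>t T. B t T \<Longrightarrow> 0 \<le> T"
    and pos: "0 < k1" "0 < k2" "0 < l1" "0 < l2" "0 \<le> \<tau>" "0 \<le> \<sigma>"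
    and expand: "l1 * l2 < k1 * k2"
  shows "\<exists>K>0. \<forall>N. \<exists>t\<ge>N. \<exists>T. A t T \<and> t \<le> K * T"
proof -
  obtain N1 c1 where 1: "\<And>t T. N1 \<le> t \<Longrightarrow> A t T \<Longrightarrow> \<exists>T'. B (t + T + \<tau>) T' \<and> k1 * T - c1 \<le> l2 * T'"
    using AB by blast
  obtain N2 c2 where 2: "\<And>t T. N2 \<le> t \<Longrightarrow> B t T \<Longrightarrow> \<exists>T'. A (t + T + \<sigma>) T' \<and> k2 * T - c2 \<le> l1 * T'"
    using BA by blast
  define c where "c = max 0 (max c1 c2)"
  have c: "0 \<le> c" "c1 \<le> c" "c2 \<le> c" by (auto simp: c_def)
  define \<mu>\<^sub>0 where "\<mu>\<^sub>0 = k1 * k2 / (l1 * l2)"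
  \<comment> \<open>A factor strictly between 1 and \<open>\<mu>\<^sub>0\<close>. The gap
    \<open>\<mu>\<^sub>0 - \<mu>\<close> absorbs the additive loss \<open>D\<close> of a loop as
    soon as \<open>T\<close> is at least \<open>M0\<close>.\<close>
  define \<mu> where "\<mu> = (1 + \<mu>\<^sub>0) / 2"
  have "1 < \<mu>\<^sub>0" using expand pos by (simp add: \<mu>\<^sub>0_def)
  then have \<mu>: "1 < \<mu>" "\<mu> < \<mu>\<^sub>0" by (auto simp: \<mu>_def)
  define D where "D = c * (k2 + l2) / (l1 * l2)"
  define M0 where "M0 = max 1 (D / (\<mu>\<^sub>0 - \<mu>))"
  \<comment> \<open>Since \<open>1 \<le> T\<close>, the product \<open>m * T\<close> bounds the
    passage \<open>T\<close> together with all constants of one loop.\<close>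
  define m where "m = 1 + \<tau> + \<sigma> + c / k2"
  have m: "1 \<le> m" using pos c by (simp add: m_def)
  \<comment> \<open>The solution of \<open>K + m + \<mu> * (l1 / k2) = \<mu> * K\<close>, which
    makes the bound \<open>t \<le> t0 + K * T\<close> reproduce itself after one loop.\<close>
  define K where "K = (m + \<mu> * (l1 / k2)) / (\<mu> - 1)"
  have "0 < K" using m \<mu> pos by (simp add: K_def add_pos_pos)
  have K: "K + m + \<mu> * (l1 / k2) = \<mu> * K"
  proof -
    have "K * (\<mu> - 1) = m + \<mu> * (l1 / k2)" using \<mu>(1) by (simp add: K_def)
    then show ?thesis by (simp only: right_diff_distrib mult.commute[of \<mu> K])
  qed
  define N0 where "N0 = max 0 (max N1 N2)"
  obtain t0 T0 where t0: "N0 \<le> t0" "M0 \<le> T0" "A t0 T0" using start by blast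
  define I where "I t T \<longleftrightarrow> N0 \<le> t \<and> M0 \<le> T \<and> A t T \<and> t \<le> t0 + K * T" for t T
  \<comment> \<open>The increment 1 makes the starting times unbounded.\<close>
  have step: "\<exists>t' T'. I t' T' \<and> t + 1 \<le> t'" if "I t T" for t T
  proof -
    have t: "N0 \<le> t" "M0 \<le> T" "A t T" "t \<le> t0 + K * T" using that by (auto simp: I_def)
    have T1: "1 \<le> T" using t(2) by (simp add: M0_def)
    obtain T1 where B: "B (t + T + \<tau>) T1" "k1 * T - c1 \<le> l2 * T1"
      using 1[of t T] t by (auto simp: N0_def)
    then have T1_pos: "0 \<le> T1" using nonneg by blast
    obtain T' where A: "A (t + T + \<tau> + T1 + \<sigma>) T'" "k2 * T1 - c2 \<le> l1 * T'"
      using 2[of "t + T + \<tau>" T1] B t T1 pos by (auto simp: N0_def)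
    have "k2 * (k1 * T - c) \<le> k2 * (l2 * T1)" using B(2) c pos by (intro mult_left_mono) auto
    moreover have "l2 * (k2 * T1 - c) \<le> l2 * (l1 * T')" using A(2) c pos by (intro mult_left_mono) auto
    ultimately have "k1 * k2 * T - c * (k2 + l2) \<le> l1 * l2 * T'"
      by (simp add: algebra_simps)
    then have "(k1 * k2 * T - c * (k2 + l2)) / (l1 * l2) \<le> T'"
      using pos by (simp add: pos_divide_le_eq mult.commute)
    then have "\<mu>\<^sub>0 * T - D \<le> T'" by (simp add: \<mu>\<^sub>0_def D_def diff_divide_distrib)
    moreover have "D \<le> (\<mu>\<^sub>0 - \<mu>) * T"
      using t(2) \<mu>(2) by (simp add: M0_def pos_divide_le_eq mult.commute)
    ultimately have grow: "\<mu> * T \<le> T'" by (simp add: algebra_simps)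
    have "T \<le> \<mu> * T" using \<mu>(1) T1 by simp
    then have "M0 \<le> T'" using grow t(2) by linarith
    \<comment> \<open>The intermediate duration is bounded by the later one \<open>T'\<close>, not
      by \<open>T\<close>: the transitions give only lower bounds on durations.\<close>
    have "T1 \<le> l1 / k2 * T' + c / k2" using A(2) c pos by (simp add: field_simps)
    moreover have "\<tau> + \<sigma> + c / k2 \<le> (\<tau> + \<sigma> + c / k2) * T"
      using mult_left_mono[OF T1, of "\<tau> + \<sigma> + c / k2"] pos c by simp
    ultimately have "t + T + \<tau> + T1 + \<sigma> \<le> t0 + (K + m) * T + l1 / k2 * T'"
      using t(4) by (simp add: m_def algebra_simps)
    also have "(K + m) * T \<le> (K + m) * (T' / \<mu>)"
      using grow \<mu>(1) \<open>0 < K\<close> m by (intro mult_left_mono) (auto simp: field_simps)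
    also have "t0 + (K + m) * (T' / \<mu>) + l1 / k2 * T' = t0 + (K + m + \<mu> * (l1 / k2)) * T' / \<mu>"
      using \<mu>(1) by (simp add: field_simps)
    also have "\<dots> = t0 + K * T'" unfolding K using \<mu>(1) by simp
    finally have "t + T + \<tau> + T1 + \<sigma> \<le> t0 + K * T'" by simp
    then have "I (t + T + \<tau> + T1 + \<sigma>) T'"
      using A(1) \<open>M0 \<le> T'\<close> t(1) T1 T1_pos pos by (simp add: I_def)
    then show ?thesis using T1 T1_pos pos by (intro exI[of _ "t + T + \<tau> + T1 + \<sigma>"] exI[of _ T']) auto
  qed
  have iter: "\<exists>t T. I t T \<and> real n \<le> t" for n
  proof (induction n)
    case 0
    have "I t0 T0" using t0 \<open>0 < K\<close> by (auto simp: I_def M0_def)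
    then show ?case using t0(1) by (auto simp: N0_def)
  next
    case (Suc n)
    then obtain t T where "I t T" "real n \<le> t" by blast
    with step[of t T] show ?case by force
  qed
  have "\<exists>t\<ge>N. \<exists>T. A t T \<and> t \<le> (K + t0) * T" for N
  proof -
    obtain n where n: "N \<le> real n" using real_arch_simple by blast
    obtain t T where "I t T" "real n \<le> t" using iter by blast
    then have tT: "N \<le> t" "A t T" "t \<le> t0 + K * T" "1 \<le> T" "0 \<le> t0"
      using n t0(1) by (auto simp: I_def M0_def N0_def)
    then have "t0 \<le> t0 * T" by (simp add: mult_le_cancel_left1)
    then have "t \<le> (K + t0) * T" using tT(3) by (simp add: algebra_simps)
    then show ?thesis using tT by blast
  qed
  moreover have "0 < K + t0" using \<open>0 < K\<close> t0(1) by (simp add: N0_def)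
  ultimately show ?thesis by blast
qed

section \<open>Existence of the gate\<close>

context saddle_chart
begin

text \<open>A point of the orbit outside the open unstable cone would be \<open>p\<close> by
  \<open>backward_in_box_stable_cone_eq\<close>, and inside the cone the modulus of \<open>u\<close>
  grows strictly. Such an orbit therefore meets each level of that modulus at most once up to time
  0.\<close>

lemma backward_in_box_strict_mono:
  assumes k: "k \<le> h0" and q: "\<And>t. t \<le> 0 \<Longrightarrow> f t q \<in> sbox k" "q \<noteq> p" and r: "r1 < r2" "r2 \<le> 0"
  shows "\<bar>s (f r2 q - p)\<bar> < \<bar>u (f r2 q - p)\<bar>" "\<bar>u (f r1 q - p)\<bar> < \<bar>u (f r2 q - p)\<bar>"
proof -
  have cone: "\<bar>s (f r q - p)\<bar> < \<bar>u (f r q - p)\<bar>" if "r \<le> 0" for r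
  proof (rule ccontr)
    assume "\<not> ?thesis"
    then have "f r q = p"
      using q(1) that k by (intro backward_in_box_stable_cone_eq[OF k]) (auto simp: flow_add[symmetric])
    then show False using flow_equilibrium_unreachable[OF V_p] q(2) by blast
  qed
  interpret perturbed_saddle "\<lambda>t. u (f t q - p)" "\<lambda>t. s (f t q - p)"
    "\<lambda>t. u (V (f t q))" "\<lambda>t. s (V (f t q))" a b e r1 r2
    by (rule orbit_perturbed_saddle[OF _ k]) (use q r in auto)
  show c2: "\<bar>s (f r2 q - p)\<bar> < \<bar>u (f r2 q - p)\<bar>" by (rule cone[OF r(2)])
  have "\<bar>u (f r1 q - p)\<bar> \<le> \<bar>u (f r2 q - p)\<bar> * exp (- (a - e) * (r2 - r1))"
    using unstable_cone_growth cone[of r1] r by simp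
  also have "\<dots> < \<bar>u (f r2 q - p)\<bar> * 1"
    using c2 r e_pos e_a by (intro mult_strict_left_mono) (auto intro: mult_neg_pos)
  finally show "\<bar>u (f r1 q - p)\<bar> < \<bar>u (f r2 q - p)\<bar>" by simp
qed

text \<open>The box is shrunk until it misses \<open>p'\<close>, the outgoing connection from time
  \<open>t1\<close> on and the incoming one before \<open>t2\<close>. On the rest of the outgoing
  connection the modulus of \<open>u\<close> is strictly monotone, so it takes the value
  \<open>h\<close> only once. The rest of the incoming one stays in \<open>sbox k1\<close> forever,
  so it cannot meet the unstable cone, which contains the exit faces.\<close>

lemma gate_exists:
  assumes p': "V p' = 0" "p' \<noteq> p"
    and out: "((\<lambda>t. f t q) \<longlongrightarrow> p) at_bot" "((\<lambda>t. f t q) \<longlongrightarrow> p') at_top"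
    and inc: "((\<lambda>t. f t r) \<longlongrightarrow> p') at_bot" "((\<lambda>t. f t r) \<longlongrightarrow> p) at_top"
    and \<gamma>: "\<gamma> = range (\<lambda>t. f t q) \<union> range (\<lambda>t. f t r) \<union> {p} \<union> {p'}"
  shows "\<exists>h y. y \<in> range (\<lambda>t. f t q) \<and> saddle_gate f V p a b e h0 C u s h y \<gamma>"
proof -
  have q_ne: "f t q \<noteq> p" for t
  proof
    assume "f t q = p"
    then have "q = p" by (rule flow_equilibrium_unreachable[OF V_p])
    then have "((\<lambda>t::real. p) \<longlongrightarrow> p') at_top" using out(2) by (simp add: flow_p)
    then show False using p'(2) by (simp add: tendsto_const_iff)
  qed
  have r_ne: "f t r \<noteq> p" for t
  proof
    assume "f t r = p"
    then have "r = p" by (rule flow_equilibrium_unreachable[OF V_p])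
    then have "((\<lambda>t::real. p) \<longlongrightarrow> p') at_bot" using inc(1) by (simp add: flow_p)
    then show False using p'(2) by (simp add: tendsto_const_iff)
  qed
  obtain k0 where k0: "k0 > 0" "p' \<notin> sbox k0"
    using avoids_box_forward[of "\<lambda>_. p'" p' 0] p'(2) by auto
  define k1 where "k1 = min h0 k0"
  have k1: "0 < k1" "k1 \<le> h0" "p' \<notin> sbox k1"
    using h0_pos k0 box_mono[of k1 k0] by (auto simp: k1_def)
  obtain t1 where t1: "\<And>t. t \<le> t1 \<Longrightarrow> f t q \<in> sbox k1"
    using eventually_in_box[OF k1(1) out(1)] by (auto simp: eventually_at_bot_linorder)
  obtain t2 where t2: "\<And>t. t2 \<le> t \<Longrightarrow> f t r \<in> sbox k1"
    using eventually_in_box[OF k1(1) inc(2)] by (auto simp: eventually_at_top_linorder)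
  obtain k2 where k2: "k2 > 0" "\<And>t. t1 \<le> t \<Longrightarrow> f t q \<notin> sbox k2"
    using avoids_box_forward[OF continuous_on_flow out(2) p'(2) q_ne, of t1] by auto
  \<comment> \<open>Reversing time brings the past of the incoming connection under
    \<open>avoids_box_forward\<close>.\<close>
  have "((\<lambda>t. f (- t) r) \<longlongrightarrow> p') at_top"
    using inc(1) by (simp add: filterlim_at_bot_mirror)
  moreover have "continuous_on UNIV (\<lambda>t. f (- t) r)"
    by (rule continuous_on_compose2[OF continuous_on_flow[of UNIV]]) (auto intro: continuous_intros)
  ultimately obtain k3 where k3: "k3 > 0" "\<And>t. - t2 \<le> t \<Longrightarrow> f (- t) r \<notin> sbox k3"
    using avoids_box_forward[of "\<lambda>t. f (- t) r" p' "- t2"] p'(2) r_ne by auto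
  define h where "h = min k1 (min k2 k3)"
  have h: "0 < h" "h \<le> k1" "h \<le> k2" "h \<le> k3" using k1 k2 k3 by (auto simp: h_def)
  define q0 where "q0 = f t1 q"
  have q0: "f t q0 \<in> sbox k1" if "t \<le> 0" for t
    using t1[of "t + t1"] that by (simp add: q0_def flow_add[symmetric])
  have q0_ne: "q0 \<noteq> p" using q_ne by (simp add: q0_def)
  note mono = backward_in_box_strict_mono[OF k1(2) q0 q0_ne]
  have "q0 \<notin> sbox h" using k2(2)[of t1] box_mono[OF h(3)] by (auto simp: q0_def)
  \<comment> \<open>In the unstable cone \<open>u\<close> is the larger coordinate, so
    \<open>q0\<close> can lie outside the box only through \<open>u\<close>.\<close>
  then have start: "h \<le> \<bar>u (f 0 q0 - p)\<bar>"
    using mono(1)[of "-1" 0] by (auto simp: coord_box_def)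
  have "((\<lambda>t. f t q0) \<longlongrightarrow> p) at_bot"
    using out(1) unfolding q0_def by (rule orbit_limit_shift)
  then have "eventually (\<lambda>t. f t q0 \<in> sbox (h / 2)) at_bot"
    using h(1) by (intro eventually_in_box) auto
  then obtain t3 where t3: "\<And>t. t \<le> t3 \<Longrightarrow> f t q0 \<in> sbox (h / 2)"
    by (auto simp: eventually_at_bot_linorder)
  have "f (min t3 0) q0 \<in> sbox (h / 2)" by (rule t3) simp
  then have "\<bar>u (f (min t3 0) q0 - p)\<bar> \<le> h" using h(1) by (simp add: coord_box_def)
  moreover have "continuous_on {min t3 0..0} (\<lambda>t. \<bar>u (f t q0 - p)\<bar>)"
    by (intro continuous_intros u.continuous_on continuous_on_flow)
  ultimately obtain ty where ty: "ty \<le> 0" "\<bar>u (f ty q0 - p)\<bar> = h"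
    using IVT'[of "\<lambda>t. \<bar>u (f t q0 - p)\<bar>" "min t3 0" h 0] start by auto
  define y where "y = f ty q0"
  have "saddle_gate f V p a b e h0 C u s h y \<gamma>"
  proof
    show "0 < h" "h \<le> h0" using h k1 by auto
    show "\<bar>u (y - p)\<bar> = h" using ty by (simp add: y_def)
    show "f t y \<in> coord_box u s p h" if "t \<le> 0" for t
    proof -
      have "\<bar>u (f (t + ty) q0 - p)\<bar> \<le> h"
        using mono(2)[of "t + ty" ty] ty that by (cases "t = 0") auto
      \<comment> \<open>The earlier time \<open>t + ty - 1\<close> is a dummy; the cone inequality
        concerns \<open>t + ty\<close> alone.\<close>
      moreover have "\<bar>s (f (t + ty) q0 - p)\<bar> < \<bar>u (f (t + ty) q0 - p)\<bar>"
        using mono(1)[of "t + ty - 1" "t + ty"] ty that by auto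
      ultimately show ?thesis by (simp add: y_def flow_add[symmetric] coord_box_def)
    qed
    show "x = y" if "x \<in> \<gamma>" and ux: "\<bar>u (x - p)\<bar> = h" and sx: "\<bar>s (x - p)\<bar> \<le> h" for x
    proof -
      have x: "x \<in> sbox k1" "x \<in> sbox k2" "x \<in> sbox k3"
        using ux sx h by (auto simp: coord_box_def)
      have "x \<noteq> p" using ux h(1) by (auto simp: u.zero)
      moreover have "x \<noteq> p'" using x(1) k1(3) by auto
      moreover have "x \<noteq> f t r" for t
      proof
        assume xt: "x = f t r"
        then have "t2 \<le> t" using k3(2)[of "- t"] x(3) by (cases "t2 \<le> t") auto
        then have "f t' x \<in> sbox k1" if "0 \<le> t'" for t'
          using t2[of "t' + t"] that by (simp add: xt flow_add[symmetric])
        then have "x = p" using ux sx by (intro forward_in_box_unstable_cone_eq[OF k1(2)]) auto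
        then show False using \<open>x \<noteq> p\<close> by simp
      qed
      ultimately obtain t where t: "x = f t q" using \<open>x \<in> \<gamma>\<close> unfolding \<gamma> by blast
      have "t < t1" using k2(2)[of t] x(2) t by (cases "t1 \<le> t") auto
      have xq0: "x = f (t - t1) q0" by (simp add: t q0_def flow_add[symmetric])
      consider "t - t1 < ty" | "t - t1 = ty" | "ty < t - t1" by linarith
      then show "x = y"
        using mono(2)[of "t - t1" ty] mono(2)[of ty "t - t1"] ux ty \<open>t < t1\<close>
        by cases (auto simp: xq0 y_def)
    qed
    show "\<exists>q\<in>\<gamma>. q \<notin> coord_box u s p h" using k1(3) box_mono[OF h(2)] by (auto simp: \<gamma>)
  qed
  moreover have "y \<in> range (\<lambda>t. f t q)" by (auto simp: y_def q0_def flow_add[symmetric])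
  ultimately show ?thesis by blast
qed

end

section \<open>Planar saddles and Bowen flows\<close>

text \<open>The coordinates come from Cramer's rule. The determinant \<open>D\<close> of the two
  eigenvectors is nonzero because parallel eigenvectors would have the same eigenvalue.\<close>

lemma eigenvector_coordinates:
  fixes A :: "real^2 \<Rightarrow> real^2"
  assumes A: "linear A" and v: "v \<noteq> 0" "A v = a *\<^sub>R v" and w: "w \<noteq> 0" "A w = c *\<^sub>R w"
    and ac: "a \<noteq> c"
  shows "\<exists>u s. linear u \<and> linear s \<and> (\<forall>x. x = u x *\<^sub>R v + s x *\<^sub>R w) \<and>
    (\<forall>x. u (A x) = a * u x) \<and> (\<forall>x. s (A x) = c * s x)"
proof -
  define D where "D = v$1 * w$2 - v$2 * w$1"
  have D: "D \<noteq> 0"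
  proof
    assume D0: "D = 0"
    have "\<exists>k. w = k *\<^sub>R v"
    proof (cases "v$1 = 0")
      case False
      then have "w = (w$1 / v$1) *\<^sub>R v"
        using D0 by (simp add: vec_eq_iff forall_2 D_def field_simps)
      then show ?thesis by blast
    next
      case True
      then have "v$2 \<noteq> 0" using v(1) by (auto simp: vec_eq_iff forall_2)
      then have "w = (w$2 / v$2) *\<^sub>R v"
        using D0 True by (simp add: vec_eq_iff forall_2 D_def field_simps)
      then show ?thesis by blast
    qed
    then obtain k where k: "w = k *\<^sub>R v" by blast
    then have "(k * a) *\<^sub>R v = (c * k) *\<^sub>R v"
      using v(2) w(2) linear_scale[OF A, of k v] by simp
    then have "k * (a - c) = 0" using v(1) by (simp add: algebra_simps)
    then show False using ac k w(1) by simp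
  qed
  define u where "u x = (x$1 * w$2 - x$2 * w$1) / D" for x :: "real^2"
  define s where "s x = (v$1 * x$2 - v$2 * x$1) / D" for x :: "real^2"
  have lin: "linear u" "linear s"
    unfolding u_def s_def by (rule linearI; simp add: algebra_simps add_divide_distrib diff_divide_distrib)+
  have dec: "x = u x *\<^sub>R v + s x *\<^sub>R w" for x
  proof -
    have "D * x$1 = (x$1 * w$2 - x$2 * w$1) * v$1 + (v$1 * x$2 - v$2 * x$1) * w$1"
      "D * x$2 = (x$1 * w$2 - x$2 * w$1) * v$2 + (v$1 * x$2 - v$2 * x$1) * w$2"
      by (simp_all add: D_def algebra_simps)
    then have "x$1 = u x * v$1 + s x * w$1" "x$2 = u x * v$2 + s x * w$2"
      using D unfolding u_def s_def times_divide_eq_left add_divide_distrib[symmetric]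
      by (simp_all only: nonzero_eq_divide_eq[OF D] mult.commute[of D])
    then show ?thesis by (simp add: vec_eq_iff forall_2)
  qed
  have vw: "u v = 1" "u w = 0" "s v = 0" "s w = 1" using D by (simp_all add: u_def s_def D_def)
  have Ax: "A x = (a * u x) *\<^sub>R v + (c * s x) *\<^sub>R w" for x
    using arg_cong[OF dec[of x], of A] v(2) w(2)
    by (simp add: linear_add[OF A] linear_scale[OF A] mult.commute)
  have "u (A x) = a * u x" "s (A x) = c * s x" for x
    unfolding Ax by (simp_all add: linear_add[OF lin(1)] linear_scale[OF lin(1)]
      linear_add[OF lin(2)] linear_scale[OF lin(2)] vw)
  with lin dec show ?thesis by blast
qed

text \<open>This is strict differentiability of \<open>V\<close> at \<open>p\<close>, written in
  eigenvector coordinates.\<close>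

lemma saddle_chart_exists:
  assumes flow: "c1_flow f V" and C1: "C1_map V" and sad: "saddle V p a b"
    and e: "0 < e" "2 * e < a" "2 * e < b"
  shows "\<exists>h0 C u s. saddle_chart f V p a b e h0 C u s"
proof -
  obtain V' where V': "\<And>x. (V has_derivative blinfun_apply (V' x)) (at x)" "continuous_on UNIV V'"
    using C1 unfolding C1_map_def by blast
  define A where "A = blinfun_apply (V' p)"
  have A: "linear A" unfolding A_def by (rule bounded_linear.linear[OF blinfun.bounded_linear_right])
  have "frechet_derivative V (at p) = A"
    unfolding A_def by (rule frechet_derivative_at[OF V'(1), symmetric])
  then obtain v w where v: "v \<noteq> 0" "A v = a *\<^sub>R v" and w: "w \<noteq> 0" "A w = (- b) *\<^sub>R w"
    and V_p: "V p = 0"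
    using sad unfolding saddle_def eigenvalue_of_def by auto
  obtain u s where lin: "linear u" "linear s" and dec: "\<And>x. x = u x *\<^sub>R v + s x *\<^sub>R w"
    and uA: "\<And>x. u (A x) = a * u x" and sA: "\<And>x. s (A x) = - b * s x"
    using eigenvector_coordinates[OF A v w] e by auto
  interpret u: bounded_linear u using lin(1) by (simp add: linear_conv_bounded_linear)
  interpret s: bounded_linear s using lin(2) by (simp add: linear_conv_bounded_linear)
  define C where "C = norm v + norm w"
  have C: "0 < C" using v(1) by (simp add: C_def add_pos_nonneg)
  have coords: "norm x \<le> C * max \<bar>u x\<bar> \<bar>s x\<bar>" for x
  proof -
    have "norm x \<le> \<bar>u x\<bar> * norm v + \<bar>s x\<bar> * norm w"
      using norm_triangle_ineq[of "u x *\<^sub>R v" "s x *\<^sub>R w"] dec[of x] by simp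
    also have "\<dots> \<le> max \<bar>u x\<bar> \<bar>s x\<bar> * norm v + max \<bar>u x\<bar> \<bar>s x\<bar> * norm w"
      by (intro add_mono mult_right_mono) auto
    finally show ?thesis by (simp add: C_def algebra_simps)
  qed
  obtain Ku where Ku: "Ku > 0" "\<And>w. \<bar>u w\<bar> \<le> norm w * Ku" using u.pos_bounded by auto
  obtain Ks where Ks: "Ks > 0" "\<And>w. \<bar>s w\<bar> \<le> norm w * Ks" using s.pos_bounded by auto
  \<comment> \<open>\<open>C\<close> passes from coordinates to the norm and \<open>Ku + Ks\<close>
    passes back, so the error in coordinates becomes exactly \<open>e\<close>.\<close>
  define \<epsilon> where "\<epsilon> = e / (C * (Ku + Ks))"
  have "0 < \<epsilon>" using e C Ku Ks by (simp add: \<epsilon>_def)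
  then obtain d where d: "d > 0" "\<And>x y. x \<in> ball p d \<Longrightarrow> y \<in> ball p d \<Longrightarrow>
      norm (V x - V y - A (x - y)) \<le> \<epsilon> * norm (x - y)"
    using continuously_differentiable_imp_strict[OF V', of \<epsilon> p] unfolding A_def by blast
  \<comment> \<open>Here \<open>C * h0 = d / 2\<close>, which places the box inside
    \<open>ball p d\<close>.\<close>
  define h0 where "h0 = d / (2 * C)"
  have ball: "x \<in> ball p d" if "x \<in> coord_box u s p h0" for x
  proof -
    have "C * max \<bar>u (x - p)\<bar> \<bar>s (x - p)\<bar> \<le> C * h0"
      using that C by (intro mult_left_mono) (auto simp: coord_box_def)
    then have "norm (x - p) \<le> d / 2" using coords[of "x - p"] C by (simp add: h0_def)
    then show ?thesis using d(1) by (simp add: dist_norm norm_minus_commute)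
  qed
  have err: "norm (V x - V y - A (x - y)) * (Ku + Ks) \<le> e * max \<bar>u (x - y)\<bar> \<bar>s (x - y)\<bar>"
    if "x \<in> coord_box u s p h0" "y \<in> coord_box u s p h0" for x y
  proof -
    have "norm (V x - V y - A (x - y)) * (Ku + Ks) \<le> \<epsilon> * norm (x - y) * (Ku + Ks)"
      using d(2)[OF ball[OF that(1)] ball[OF that(2)]] Ku(1) Ks(1) by (intro mult_right_mono) auto
    also have "\<dots> \<le> \<epsilon> * (C * max \<bar>u (x - y)\<bar> \<bar>s (x - y)\<bar>) * (Ku + Ks)"
      using coords[of "x - y"] \<open>0 < \<epsilon>\<close> Ku(1) Ks(1) by (intro mult_right_mono mult_left_mono) auto
    also have "\<dots> = \<epsilon> * (C * (Ku + Ks)) * max \<bar>u (x - y)\<bar> \<bar>s (x - y)\<bar>" by (simp add: mult_ac)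
    also have "\<epsilon> * (C * (Ku + Ks)) = e" using C Ku(1) Ks(1) by (simp add: \<epsilon>_def)
    finally show ?thesis .
  qed
  have "saddle_chart f V p a b e h0 C u s"
  proof (intro saddle_chart.intro[OF flow] saddle_chart_axioms.intro)
    fix x y assume xy: "x \<in> coord_box u s p h0" "y \<in> coord_box u s p h0"
    define z where "z = V x - V y - A (x - y)"
    have "u (V x - V y) - a * u (x - y) = u z" "s (V x - V y) + b * s (x - y) = s z"
      by (simp_all add: z_def u.diff[of "V x - V y"] s.diff[of "V x - V y"] uA sA)
    moreover have "\<bar>u z\<bar> \<le> norm z * (Ku + Ks)" "\<bar>s z\<bar> \<le> norm z * (Ku + Ks)"
      using Ku(2)[of z] Ks(2)[of z] mult_nonneg_nonneg[of "norm z" Ku] mult_nonneg_nonneg[of "norm z" Ks]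
        Ku(1) Ks(1) by (auto simp: distrib_left)
    ultimately show "\<bar>u (V x - V y) - a * u (x - y)\<bar> \<le> e * max \<bar>u (x - y)\<bar> \<bar>s (x - y)\<bar>"
      "\<bar>s (V x - V y) + b * s (x - y)\<bar> \<le> e * max \<bar>u (x - y)\<bar> \<bar>s (x - y)\<bar>"
      using err[OF xy] unfolding z_def by linarith+
  qed (use V_p u.bounded_linear_axioms s.bounded_linear_axioms C coords e d in \<open>auto simp: h0_def\<close>)
  then show ?thesis by blast
qed

text \<open>Returns to the regular point \<open>y\<close> force the limit 0, while midpoints of
  passages with \<open>t \<le> K * T\<close> give values below a fixed negative number at
  arbitrarily late times.\<close>

lemma (in saddle_gate) irregular:
  assumes C1: "C1_map V" and om: "omega_limit_set f x = \<gamma>" and y: "y \<in> \<gamma>"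
    and K: "0 < K" "\<And>N. \<exists>t\<ge>N. \<exists>T. passage x t T \<and> t \<le> K * T"
  shows "lyapunov_irregular f x (V x)"
proof -
  have y_box: "y \<in> sbox h" using y_backward[of 0] by simp
  \<comment> \<open>An equilibrium \<open>y\<close> would stay in the box forever while lying in the
    unstable cone, hence would be \<open>p\<close>, where \<open>u (y - p)\<close> vanishes.\<close>
  have Vy: "V y \<noteq> 0"
  proof
    assume "V y = 0"
    then have "f t y \<in> sbox h" for t using y_box by (simp add: flow_equilibrium)
    then have "y = p"
      using y_box u_y by (intro forward_in_box_unstable_cone_eq[OF h_le]) (auto simp: coord_box_def)
    then show False using u_y h_pos by (simp add: u.zero)
  qed
  \<comment> \<open>A constant orbit has no limit point other than \<open>x\<close>, but \<gamma>
    contains \<open>y\<close> in the box and another point outside it.\<close>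
  have Vx: "V (f t x) \<noteq> 0" for t
  proof
    assume "V (f t x) = 0"
    then have "V x = 0" using flow_equilibrium_unreachable[of "f t x" t x] by simp
    then have const: "f t x = x" for t by (rule flow_equilibrium)
    have eq: "q = x" if "q \<in> \<gamma>" for q
    proof (rule ccontr)
      assume "q \<noteq> x"
      then have "q \<in> omega_limit_set f x" "0 < dist x q" using om that by auto
      then obtain t where "dist (f t x) q < dist x q"
        using omega_limit_frequently by blast
      then show False by (simp add: const)
    qed
    obtain q where "q \<in> \<gamma>" "q \<notin> sbox h" using leaves by blast
    then show False using eq[of q] eq[OF y] y_box by simp
  qed
  define g where "g t = ln (norm (V (f t x)))" for t
  show ?thesis
    unfolding lyapunov_irregular_def frechet_derivative_flow_field
  proof
    assume "\<exists>L. ((\<lambda>t. ereal (1 / t * ln (norm (V (f t x))))) \<longlongrightarrow> L) at_top"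
    then obtain L where L: "((\<lambda>t. ereal (1 / t * g t)) \<longlongrightarrow> L) at_top"
      unfolding g_def by blast
    obtain \<tau> where \<tau>: "filterlim \<tau> at_top sequentially" "(\<lambda>n::nat. f (\<tau> n) x) \<longlonglongrightarrow> y"
      using y om unfolding omega_limit_set_def by blast
    have "isCont V y"
      using C1 has_derivative_continuous unfolding C1_map_def by blast
    from isCont_tendsto_compose[OF this \<tau>(2)]
    have "(\<lambda>n. g (\<tau> n)) \<longlonglongrightarrow> ln (norm (V y))"
      unfolding g_def using Vy by (intro tendsto_ln tendsto_norm) auto
    from tendsto_mult[OF tendsto_inverse_0_at_top[OF \<tau>(1)] this]
    have "(\<lambda>n. ereal (1 / \<tau> n * g (\<tau> n))) \<longlonglongrightarrow> ereal 0"
      by (simp add: inverse_eq_divide)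
    moreover have "(\<lambda>n. ereal (1 / \<tau> n * g (\<tau> n))) \<longlonglongrightarrow> L"
      by (rule filterlim_compose[OF L \<tau>(1)])
    ultimately have L0: "L = ereal 0" using LIMSEQ_unique by blast
    \<comment> \<open>The midpoint time is at most \<open>(K + 1) * T\<close>, so a quotient above
      \<open>- \<delta>\<close> means a logarithm above \<open>- e * T / 8\<close>; the passage
      gives at most \<open>- e * T / 4\<close>.\<close>
    define \<delta> where "\<delta> = e / (8 * (K + 1))"
    have \<delta>: "0 < \<delta>" using e_pos K by (simp add: \<delta>_def)
    then have "eventually (\<lambda>t. ereal (- \<delta>) < ereal (1 / t * g t)) at_top"
      using order_tendstoD(1)[OF L, of "ereal (- \<delta>)"] by (simp add: L0)
    then obtain N where N: "\<And>t. N \<le> t \<Longrightarrow> - \<delta> < 1 / t * g t"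
      by (auto simp: eventually_at_top_linorder)
    define D where "D = C * ((a + b + e) * h)"
    have D: "0 < D" using C_pos h_pos e_pos e_a e_b by (simp add: D_def)
    \<comment> \<open>For \<open>T\<close> at least \<open>M\<close>, half of the decay
      \<open>e * T / 2\<close> absorbs \<open>ln D\<close>.\<close>
    define M where "M = max 1 (4 * ln D / e)"
    \<comment> \<open>Asking for \<open>K * M \<le> t\<close> forces \<open>M \<le> T\<close>
      through \<open>t \<le> K * T\<close>.\<close>
    obtain t T where t: "max N (K * M) \<le> t" and P: "passage x t T" and tT: "t \<le> K * T"
      using K(2) by blast
    have "K * M \<le> K * T" using t tT by simp
    then have T: "1 \<le> T" "4 * ln D / e \<le> T" using K(1) by (auto simp: M_def)
    have t_pos: "0 < t"
    proof -
      have "0 < K * M" using K(1) by (simp add: M_def)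
      then show ?thesis using t by simp
    qed
    define r where "r = t + T / 2"
    have r: "0 < r" "N \<le> r" "r \<le> (K + 1) * T"
      using t t_pos tT T by (auto simp: r_def algebra_simps)
    have "g r \<le> ln (D * exp (- e * (T / 2)))"
      unfolding g_def r_def using passage_speed[OF P] Vx
      by (intro ln_mono) (auto simp: D_def mult_ac)
    also have "\<dots> = ln D - e * T / 2" using D by (simp add: ln_mult_pos)
    also have "ln D \<le> e * T / 4" using T(2) e_pos by (simp add: field_simps)
    finally have gr: "g r \<le> - (e * T / 4)" by (simp add: mult.commute)
    have "- \<delta> * r < g r" using N[OF r(2)] r(1) by (simp add: field_simps)
    moreover have "\<delta> * r \<le> \<delta> * ((K + 1) * T)" using r(3) \<delta> by (intro mult_left_mono) auto
    moreover have "\<delta> * ((K + 1) * T) = e * T / 8"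
    proof -
      have "\<delta> * (K + 1) = e / 8" using K(1) by (simp add: \<delta>_def field_simps)
      then show ?thesis by (simp only: mult.assoc[symmetric] times_divide_eq_left)
    qed
    moreover have "0 < e * T" using e_pos T by simp
    ultimately show False using gr by linarith
  qed
qed

text \<open>At \<open>e = 0\<close> the strict inequalities between the eigenvalues are the
  hypotheses, and by continuity they persist for small positive \<open>e\<close>.\<close>

lemma exists_small_perturbation:
  fixes a b a' b' :: real
  assumes "0 < a" "0 < b" "0 < a'" "0 < b'" "a * a' < b * b'"
  shows "\<exists>e>0. 2 * e < a \<and> 2 * e < b \<and> 2 * e < a' \<and> 2 * e < b' \<and>
    (a + 2 * e) * (a' + 2 * e) < (b - e) * (b' - e)"
proof -
  have lim: "((\<lambda>e. (b - e) * (b' - e) - (a + 2 * e) * (a' + 2 * e)) \<longlongrightarrow>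
      (b - 0) * (b' - 0) - (a + 2 * 0) * (a' + 2 * 0)) (at_right 0)"
    by (intro tendsto_intros)
  have small: "eventually (\<lambda>e. 2 * e < k) (at_right 0)" if "0 < k" for k :: real
    using eventually_at_right_real[of 0 "k / 2"] that by (auto elim: eventually_mono)
  have "eventually (\<lambda>e. 0 < (b - e) * (b' - e) - (a + 2 * e) * (a' + 2 * e)) (at_right 0)"
    using order_tendstoD(1)[OF lim, of 0] assms(5) by simp
  with small[OF assms(1)] small[OF assms(2)] small[OF assms(3)] small[OF assms(4)]
    eventually_at_right_less[of "0::real"]
  have "eventually (\<lambda>e. 0 < e \<and> 2 * e < a \<and> 2 * e < b \<and> 2 * e < a' \<and> 2 * e < b' \<and>
      (a + 2 * e) * (a' + 2 * e) < (b - e) * (b' - e)) (at_right 0)"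
    by eventually_elim auto
  then show ?thesis using eventually_happens'[OF trivial_limit_at_right_real] by blast
qed

theorem proposition1p1:
  fixes f :: "real \<Rightarrow> real^2 \<Rightarrow> real^2"
    and V :: "real^2 \<Rightarrow> real^2"
    and \<gamma> U :: "(real^2) set"
  assumes "bowen_flow f V \<gamma>"
    and "open U" and "U \<subseteq> inside \<gamma>"
    and "\<And>x. x \<in> U \<Longrightarrow> omega_limit_set f x = \<gamma>"
  shows "\<forall>x\<in>U. lyapunov_irregular f x (V x)"
proof
  fix x assume "x \<in> U"
  then have om: "omega_limit_set f x = \<gamma>" by (rule assms(4))
  obtain \<alpha> p p' \<gamma>\<^sub>1 \<gamma>\<^sub>2 a b a' b' where flow: "smooth_flow f" "generated_by f V"
    and \<alpha>: "0 < \<alpha>" "C1_Holder \<alpha> V"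
    and sad: "saddle V p a b" "saddle V p' a' b'"
    and het: "heteroclinic_orbit f p p' \<gamma>\<^sub>1" "heteroclinic_orbit f p' p \<gamma>\<^sub>2"
    and \<gamma>: "\<gamma> = \<gamma>\<^sub>1 \<union> \<gamma>\<^sub>2 \<union> {p} \<union> {p'}" and eig: "a * a' < b * b'"
    using assms(1) unfolding bowen_flow_def by blast
  interpret c1_flow f V using flow by unfold_locales
  have C1: "C1_map V" using \<alpha> C1_Holder_imp_C1_map by blast
  obtain q q' where q: "\<gamma>\<^sub>1 = range (\<lambda>t. f t q)" "\<gamma>\<^sub>2 = range (\<lambda>t. f t q')" and ne: "p \<noteq> p'"
    using het unfolding heteroclinic_orbit_def flow_orbit_def by blast
  have "q \<in> \<gamma>\<^sub>1" "q' \<in> \<gamma>\<^sub>2" unfolding q by (metis flow_0 rangeI)+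
  then have lim: "((\<lambda>t. f t q) \<longlongrightarrow> p) at_bot" "((\<lambda>t. f t q) \<longlongrightarrow> p') at_top"
    "((\<lambda>t. f t q') \<longlongrightarrow> p') at_bot" "((\<lambda>t. f t q') \<longlongrightarrow> p) at_top"
    using het by (auto simp: heteroclinic_orbit_def stable_manifold_def unstable_manifold_def)
  obtain e where e: "0 < e" "2 * e < a" "2 * e < b" "2 * e < a'" "2 * e < b'"
    "(a + 2 * e) * (a' + 2 * e) < (b - e) * (b' - e)"
    using exists_small_perturbation[of a b a' b'] sad eig unfolding saddle_def by blast
  obtain h0 C u s where P: "saddle_chart f V p a b e h0 C u s"
    using saddle_chart_exists[OF c1_flow_axioms C1 sad(1)] e by blast
  obtain h0' C' u' s' where Q: "saddle_chart f V p' a' b' e h0' C' u' s'"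
    using saddle_chart_exists[OF c1_flow_axioms C1 sad(2)] e by blast
  have V0: "V p = 0" "V p' = 0" using sad by (auto simp: saddle_def)
  obtain h y where y: "y \<in> range (\<lambda>t. f t q)" and gP: "saddle_gate f V p a b e h0 C u s h y \<gamma>"
    using saddle_chart.gate_exists[OF P V0(2) ne[symmetric] lim \<gamma>[unfolded q]] by blast
  \<comment> \<open>The same curve with the saddles exchanged, in the form that
    \<open>gate_exists\<close> expects at \<open>p'\<close>.\<close>
  have "\<gamma> = range (\<lambda>t. f t q') \<union> range (\<lambda>t. f t q) \<union> {p'} \<union> {p}" unfolding \<gamma> q by blast
  from saddle_chart.gate_exists[OF Q V0(1) ne lim(3,4,1,2) this]
  obtain h' y' where y': "y' \<in> range (\<lambda>t. f t q')"
    and gQ: "saddle_gate f V p' a' b' e h0' C' u' s' h' y' \<gamma>" by blast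
  interpret P: saddle_gate f V p a b e h0 C u s h y \<gamma> by (rule gP)
  interpret Q: saddle_gate f V p' a' b' e h0' C' u' s' h' y' \<gamma> by (rule gQ)
  have "((\<lambda>t. f t y) \<longlongrightarrow> p') at_top" using y orbit_limit_shift(1)[OF lim(2)] by auto
  then have "eventually (\<lambda>t. f t y \<in> coord_box u' s' p' (h' / 2)) at_top"
    using Q.h_pos by (intro Q.eventually_in_box) auto
  \<comment> \<open>The conjunct \<open>0 \<le> t\<close> makes the travel time nonnegative, as
    \<open>geometric_passage_times\<close> requires.\<close>
  with eventually_ge_at_top[of 0]
  have "eventually (\<lambda>t. 0 \<le> t \<and> f t y \<in> coord_box u' s' p' (h' / 2)) at_top"
    by (rule eventually_conj)
  then obtain \<tau> where \<tau>: "\<And>t. \<tau> \<le> t \<Longrightarrow> 0 \<le> t \<and> f t y \<in> coord_box u' s' p' (h' / 2)"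
    by (auto simp: eventually_at_top_linorder)
  have "((\<lambda>t. f t y') \<longlongrightarrow> p) at_top" using y' orbit_limit_shift(1)[OF lim(4)] by auto
  then have "eventually (\<lambda>t. f t y' \<in> coord_box u s p (h / 2)) at_top"
    using P.h_pos by (intro P.eventually_in_box) auto
  with eventually_ge_at_top[of 0]
  have "eventually (\<lambda>t. 0 \<le> t \<and> f t y' \<in> coord_box u s p (h / 2)) at_top"
    by (rule eventually_conj)
  then obtain \<sigma> where \<sigma>: "\<And>t. \<sigma> \<le> t \<Longrightarrow> 0 \<le> t \<and> f t y' \<in> coord_box u s p (h / 2)"
    by (auto simp: eventually_at_top_linorder)
  interpret PQ: heteroclinic_connection f V p a b e h0 C u s h y \<gamma> p' a' b' e h0' C' u' s' h' y' \<tau>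
    by unfold_locales (use \<tau> in auto)
  interpret QP: heteroclinic_connection f V p' a' b' e h0' C' u' s' h' y' \<gamma> p a b e h0 C u s h y \<sigma>
    by unfold_locales (use \<sigma> in auto)
  have "\<exists>K>0. \<forall>N. \<exists>t\<ge>N. \<exists>T. P.passage x t T \<and> t \<le> K * T"
  \<comment> \<open>The rates are \<open>k1 = b - e\<close>, \<open>l2 = a' + 2 * e\<close>,
    \<open>k2 = b' - e\<close> and \<open>l1 = a + 2 * e\<close>, so the expansion condition is the
    last property of \<open>e\<close>.\<close>
  proof (rule geometric_passage_times[OF PQ.transition[OF om] QP.transition[OF om]])
    show "\<exists>t\<ge>N. \<exists>T\<ge>M. P.passage x t T" for M N
      using \<gamma> by (intro P.long_passages[OF om]) auto
    show "0 \<le> T" if "P.passage x t T" for t T using that by (simp add: P.passage_def)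
    show "0 \<le> T" if "Q.passage x t T" for t T using that by (simp add: Q.passage_def)
  qed (use e \<tau>[of \<tau>] \<sigma>[of \<sigma>] in auto)
  then obtain K where K: "0 < K" "\<And>N. \<exists>t\<ge>N. \<exists>T. P.passage x t T \<and> t \<le> K * T" by blast
  show "lyapunov_irregular f x (V x)"
    using y \<gamma> q K by (intro P.irregular[OF C1 om]) auto
qed

end
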